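(* Let $G$ be a finite simple graph of order $n$ with $v_{even}(G)\in\{1,2\}$. Then $\gamma_s'(G)\le n-1$.
   Context: For a simple graph $G=(V,E)$ and an edge $e=uv$, let $N[e]=E_G(u)\cup E_G(v)$, where $E_G(x)$ is the set of edges of $G$ incident with $x$. A signed edge domination function (SEDF) of $G$ is a function $f:E\to\{1,-1\}$ such that $\sum_{e'\in N[e]}f(e')\ge 1$ for every $e\in E$. The signed edge domination number $\gamma_s'(G)$ is the minimum of $f(G)=\sum_{e\in E}f(e)$ over all SEDFs $f$ of $G$. $v_{even}(G)$ denotes the number of vertices of even degree in $G$. *)

theory Defs
  imports Main
begin

definition simple_graph :: "'a set \<Rightarrow> 'a set set \<Rightarrow> bool" where
  "simple_graph V E \<longleftrightarrow> finite V \<and> (\<forall>e\<in>E. e \<subseteq> V \<and> card e = 2)"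

definition incident_edges :: "'a set set \<Rightarrow> 'a \<Rightarrow> 'a set set" where
  "incident_edges E x = {e\<in>E. x \<in> e}"

definition degree :: "'a set set \<Rightarrow> 'a \<Rightarrow> nat" where
  "degree E x = card (incident_edges E x)"

definition closed_edge_nbhd :: "'a set set \<Rightarrow> 'a set \<Rightarrow> 'a set set" where
  "closed_edge_nbhd E e = (\<Union>x\<in>e. incident_edges E x)"

definition v_even :: "'a set \<Rightarrow> 'a set set \<Rightarrow> nat" where
  "v_even V E = card {v\<in>V. even (degree E v)}"

definition is_SEDF :: "'a set set \<Rightarrow> ('a set \<Rightarrow> int) \<Rightarrow> bool" where
  "is_SEDF E f \<longleftrightarrow> (\<forall>e\<in>E. f e \<in> {1, -1}) \<and>
     (\<forall>e\<in>E. (\<Sum>e'\<in>closed_edge_nbhd E e. f e') \<ge> 1)"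

definition signed_edge_domination_number :: "'a set set \<Rightarrow> int" where
  "signed_edge_domination_number E = Min {(\<Sum>e\<in>E. f e) | f. is_SEDF E f}"

end

theory Submission
  imports Defs
begin

text \<open>
  Call a signing \<open>f\<close> a star function if the sum of \<open>f\<close> over the edges at each non-isolated vertex is
  at least 1; every star function is an SEDF. From an edge set remove a maximal subset \<open>B\<close> that
  admits a signing with all vertex sums 0, and choose a maximal forest \<open>A\<close> in what is left. The
  remaining edges \<open>R\<close> form a matching: two of them sharing a vertex, together with paths of \<open>A\<close>,
  would contain an even closed trail, and an alternating signing of that trail would enlarge \<open>B\<close>.
  Sign \<open>B\<close> with sums 0, \<open>A\<close> positively and \<open>R\<close> negatively. The total is \<open>|A| - |R|\<close>, and every vertex
  of odd degree has sum at least 1.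

  If all degrees but that of \<open>u\<close> are odd, only \<open>u\<close> may need a correction, namely flipping one
  negative edge at \<open>u\<close>. If \<open>u\<close> and \<open>v\<close> are the even vertices and lie in one component, apply the
  construction to the complement of a shortest path from \<open>u\<close> to \<open>v\<close>, and sign the path itself
  alternately with positive end edges (with one repetition of the positive sign when its length is
  even). The resulting total exceeds \<open>n - 1\<close> only if \<open>A\<close> is almost spanning and \<open>|R| \<le> 1\<close>. Then
  flipping an alternating trail of one or three edges between vertices with large sums lowers the
  total by 2, unless \<open>A\<close> consists of stars, \<open>B\<close> is empty and \<open>G\<close> has exactly \<open>n\<close> edges. These
  graphs need an SEDF that is not a star function: it is \<open>-1\<close> on exactly one edge, at \<open>u\<close>.
\<close>

subsection \<open>Vertex sums of signings\<close>

text \<open>Summing an indicator over all of \<open>E\<close> makes vertex sums additive over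
  disjoint unions and lets double sums be swapped. With the constant signing 1 this is the degree,
  as an integer.\<close>

definition nsum :: "'a set set \<Rightarrow> ('a set \<Rightarrow> int) \<Rightarrow> 'a \<Rightarrow> int" where
  "nsum E f x = (\<Sum>e\<in>E. if x \<in> e then f e else 0)"

abbreviation ndeg :: "'a set set \<Rightarrow> 'a \<Rightarrow> int" where
  "ndeg E \<equiv> nsum E (\<lambda>_. 1)"

definition edges2 :: "'a set set \<Rightarrow> bool" where
  "edges2 E \<longleftrightarrow> finite E \<and> (\<forall>e\<in>E. card e = 2)"

definition signing :: "'a set set \<Rightarrow> ('a set \<Rightarrow> int) \<Rightarrow> bool" where
  "signing E f \<longleftrightarrow> (\<forall>e\<in>E. f e = 1 \<or> f e = -1)"

definition star_fun :: "'a set set \<Rightarrow> ('a set \<Rightarrow> int) \<Rightarrow> bool" where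
  "star_fun E f \<longleftrightarrow> signing E f \<and> (\<forall>e\<in>E. \<forall>x\<in>e. nsum E f x \<ge> 1)"

text \<open>For a finite set of two-element edges these are the edge-disjoint unions of closed
  trails of even length, signed alternately.\<close>

definition balanced :: "'a set set \<Rightarrow> ('a set \<Rightarrow> int) \<Rightarrow> bool" where
  "balanced B g \<longleftrightarrow> signing B g \<and> (\<forall>x. nsum B g x = 0)"

definition conn :: "'a set set \<Rightarrow> 'a \<Rightarrow> 'a \<Rightarrow> bool" where
  "conn A x y \<longleftrightarrow> (x, y) \<in> {(a, b). {a, b} \<in> A}\<^sup>*"

text \<open>Acyclicity in the form of Kruskal's algorithm: every new edge joins two components. Edge
  counts and two-colourings then follow by induction. Loops are excluded since \<open>conn\<close>
  is reflexive.\<close>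

inductive forest :: "'a set set \<Rightarrow> bool" where
  forest_empty: "forest {}"
| forest_insert: "forest A \<Longrightarrow> \<not> conn A a b \<Longrightarrow> forest (insert {a, b} A)"

fun pedges :: "'a list \<Rightarrow> 'a set set" where
  "pedges (x # y # zs) = insert {x, y} (pedges (y # zs))"
| "pedges _ = {}"

lemma edges2D: "edges2 E \<Longrightarrow> e \<in> E \<Longrightarrow> \<exists>x y. e = {x, y} \<and> x \<noteq> y"
  by (auto simp: edges2_def card_2_iff)

lemma edges2_finite: "edges2 E \<Longrightarrow> finite E"
  by (simp add: edges2_def)

lemma edges2_subset: "edges2 E \<Longrightarrow> A \<subseteq> E \<Longrightarrow> edges2 A"
  by (auto simp: edges2_def intro: finite_subset)

lemma edges2_neq: "edges2 E \<Longrightarrow> {x, y} \<in> E \<Longrightarrow> x \<noteq> y"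
  by (auto simp: edges2_def)

lemma nsum_Un: "finite A \<Longrightarrow> finite B \<Longrightarrow> A \<inter> B = {} \<Longrightarrow> nsum (A \<union> B) f x = nsum A f x + nsum B f x"
  by (simp add: nsum_def sum.union_disjoint)

lemma nsum_cong: "(\<And>e. e \<in> A \<Longrightarrow> f e = g e) \<Longrightarrow> nsum A f x = nsum A g x"
  by (auto simp: nsum_def intro!: sum.cong)

lemma nsum_empty [simp]: "nsum {} f x = 0"
  by (simp add: nsum_def)

lemma nsum_insert: "finite A \<Longrightarrow> e \<notin> A \<Longrightarrow> nsum (insert e A) f x = (if x \<in> e then f e else 0) + nsum A f x"
  by (simp add: nsum_def)

lemma nsum_uminus: "nsum A (\<lambda>e. - f e) x = - nsum A f x"
  unfolding nsum_def sum_negf[symmetric] by (rule sum.cong) auto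

lemma sum_upd:
  fixes f :: "'b \<Rightarrow> int"
  assumes "finite E" "e \<in> E"
  shows "sum (f(e := c)) E = sum f E + c - f e"
proof -
  have "sum (f(e := c)) E = c + sum (f(e := c)) (E - {e})"
    using assms by (simp add: sum.remove)
  also have "sum (f(e := c)) (E - {e}) = sum f (E - {e})"
    by (rule sum.cong) auto
  finally show ?thesis
    using assms by (simp add: sum.remove)
qed

lemma nsum_upd:
  assumes "finite E" "e \<in> E"
  shows "nsum E (f(e := c)) x = nsum E f x + (if x \<in> e then c - f e else 0)"
proof -
  have "nsum E (f(e := c)) x = sum ((\<lambda>d. if x \<in> d then f d else 0)(e := if x \<in> e then c else 0)) E"
    unfolding nsum_def by (rule sum.cong) auto
  also have "\<dots> = nsum E f x + (if x \<in> e then c else 0) - (if x \<in> e then f e else 0)"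
    using sum_upd[OF assms] unfolding nsum_def by blast
  finally show ?thesis by simp
qed

lemma nsum_incident: "finite E \<Longrightarrow> nsum E f x = sum f (incident_edges E x)"
  by (simp add: nsum_def incident_edges_def sum.inter_filter)

lemma ndeg_degree: "finite E \<Longrightarrow> ndeg E x = int (degree E x)"
  by (simp add: nsum_incident degree_def)

lemma ndeg_nonneg: "ndeg E x \<ge> 0"
  by (auto simp: nsum_def intro: sum_nonneg)

lemma ndeg_mono: "finite E \<Longrightarrow> A \<subseteq> E \<Longrightarrow> ndeg A x \<le> ndeg E x"
  unfolding nsum_def by (rule sum_mono2) auto

lemma ndeg_ge_card:
  assumes "finite E" "F \<subseteq> E" "\<forall>e\<in>F. x \<in> e"
  shows "ndeg E x \<ge> int (card F)"
proof -
  have "ndeg F x = int (card F)"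
    using assms(3) by (simp add: nsum_def)
  then show ?thesis using ndeg_mono[OF assms(1,2), of x] by simp
qed

lemma ndeg_ge1: "finite E \<Longrightarrow> e \<in> E \<Longrightarrow> x \<in> e \<Longrightarrow> ndeg E x \<ge> 1"
  using ndeg_ge_card[of E "{e}" x] by simp

lemma ndeg_ge2: "finite E \<Longrightarrow> e \<in> E \<Longrightarrow> x \<in> e \<Longrightarrow> e' \<in> E \<Longrightarrow> x \<in> e' \<Longrightarrow> e \<noteq> e' \<Longrightarrow> ndeg E x \<ge> 2"
  using ndeg_ge_card[of E "{e, e'}" x] by simp

lemma nsum_outside: "(\<And>e. e \<in> E \<Longrightarrow> x \<notin> e) \<Longrightarrow> nsum E f x = 0"
  by (simp add: nsum_def)

text \<open>In the difference of the two sums every summand \<open>f e - 1\<close> is 0 or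
  -2.\<close>

lemma signing_parity:
  assumes "finite E" "signing E f"
  shows "even (nsum E f x) \<longleftrightarrow> even (ndeg E x)"
proof -
  have "nsum E f x - ndeg E x = (\<Sum>e\<in>E. (if x \<in> e then f e - 1 else 0))"
    unfolding nsum_def sum_subtractf[symmetric] by (rule sum.cong) auto
  moreover have "2 dvd (\<Sum>e\<in>E. (if x \<in> e then f e - 1 else 0))"
    using assms(2) by (intro dvd_sum) (auto simp: signing_def)
  ultimately show ?thesis by presburger
qed

text \<open>The edge itself is the only one containing both \<open>x\<close> and \<open>y\<close>,
  so by inclusion-exclusion its closed neighbourhood has the two vertex sums minus the doubly
  counted value as its sum.\<close>

lemma is_SEDF_I:
  assumes E: "edges2 E" and f: "signing E f"
    and le: "\<And>x y. {x, y} \<in> E \<Longrightarrow> x \<noteq> y \<Longrightarrow> nsum E f x + nsum E f y - f {x, y} \<ge> 1"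
  shows "is_SEDF E f"
  unfolding is_SEDF_def
proof (intro conjI ballI)
  fix e assume "e \<in> E"
  then show "f e \<in> {1, - 1}" using f by (auto simp: signing_def)
next
  fix e assume e: "e \<in> E"
  then obtain x y where xy: "e = {x, y}" "x \<noteq> y" using edges2D[OF E] by blast
  have fin: "finite (incident_edges E z)" for z
    using E by (auto simp: edges2_def incident_edges_def)
  have "d = {x, y}" if "d \<in> E" "x \<in> d" "y \<in> d" for d
    using edges2D[OF E that(1)] that(2,3) xy(2) by auto
  then have int: "incident_edges E x \<inter> incident_edges E y = {e}"
    using e xy unfolding incident_edges_def by blast
  have "closed_edge_nbhd E e = incident_edges E x \<union> incident_edges E y"
    by (auto simp: closed_edge_nbhd_def xy)
  then have "sum f (closed_edge_nbhd E e) + f e = nsum E f x + nsum E f y"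
    using sum.union_inter[OF fin fin, of f x y] int
    by (simp add: nsum_incident[OF edges2_finite[OF E]])
  moreover have "nsum E f x + nsum E f y - f e \<ge> 1"
    using le[of x y] e xy by blast
  ultimately show "sum f (closed_edge_nbhd E e) \<ge> 1"
    by linarith
qed

text \<open>The doubly counted edge takes away at most 1 from \<open>1 + 1\<close>.\<close>

lemma star_fun_is_SEDF:
  assumes E: "edges2 E" and f: "star_fun E f"
  shows "is_SEDF E f"
proof (rule is_SEDF_I[OF E])
  show "signing E f" using f by (simp add: star_fun_def)
next
  fix x y assume "{x, y} \<in> E"
  with f have "nsum E f x \<ge> 1" "nsum E f y \<ge> 1" "f {x, y} \<le> 1"
    by (auto simp: star_fun_def signing_def)
  then show "nsum E f x + nsum E f y - f {x, y} \<ge> 1" by simp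
qed

text \<open>\<open>Min\<close> is a lower bound only for a finite set. The possible totals are
  integers of absolute value at most \<open>card E\<close>.\<close>

lemma sedn_le:
  assumes E: "finite E" and f: "is_SEDF E f"
  shows "signed_edge_domination_number E \<le> sum f E"
proof -
  let ?A = "{(\<Sum>e\<in>E. f e) | f. is_SEDF E f}"
  have "?A \<subseteq> {- int (card E)..int (card E)}"
  proof clarify
    fix h :: "'a set \<Rightarrow> int" assume "is_SEDF E h"
    then have h: "\<bar>h e\<bar> \<le> 1" if "e \<in> E" for e using that by (auto simp: is_SEDF_def)
    have "\<bar>sum h E\<bar> \<le> (\<Sum>e\<in>E. \<bar>h e\<bar>)" by (rule sum_abs)
    also have "\<dots> \<le> int (card E)" using sum_bounded_above[of E "\<lambda>e. \<bar>h e\<bar>" 1] h by simp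
    finally show "sum h E \<in> {- int (card E)..int (card E)}" by auto
  qed
  then have "finite ?A" by (rule finite_subset) simp
  then show ?thesis
    unfolding signed_edge_domination_number_def using f by (intro Min_le) auto
qed

subsection \<open>Forests and alternating paths\<close>

lemma conn_refl [simp]: "conn A x x"
  by (simp add: conn_def)

lemma conn_sym: "conn A x y \<Longrightarrow> conn A y x"
proof -
  have "sym {(a, b). {a, b} \<in> A}" by (auto simp: sym_def insert_commute)
  then show "conn A x y \<Longrightarrow> conn A y x"
    unfolding conn_def by (blast dest: sym_rtrancl symD)
qed

lemma conn_trans: "conn A x y \<Longrightarrow> conn A y z \<Longrightarrow> conn A x z"
  unfolding conn_def by (rule rtrancl_trans)

lemma conn_edge: "{x, y} \<in> A \<Longrightarrow> conn A x y"
  unfolding conn_def by auto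

lemma conn_mono: "conn A x y \<Longrightarrow> A \<subseteq> B \<Longrightarrow> conn B x y"
  unfolding conn_def by (erule rev_subsetD, rule rtrancl_mono) auto

lemma conn_induct [consumes 1, case_names refl step]:
  assumes "conn A x y" "P x" "\<And>y z. conn A x y \<Longrightarrow> {y, z} \<in> A \<Longrightarrow> P y \<Longrightarrow> P z"
  shows "P y"
  using assms(1) unfolding conn_def
  by (induction rule: rtrancl_induct) (use assms(2,3) in \<open>auto simp: conn_def\<close>)

lemma conn_isolated:
  assumes "conn A x y" "\<And>e. e \<in> A \<Longrightarrow> x \<notin> e"
  shows "y = x"
  using assms(1) by (induction rule: conn_induct) (use assms(2) in auto)

text \<open>\<open>S\<close> holds at most one vertex of each component, so this is the usual count
  of edges and components. Removing the last edge \<open>{a, b}\<close> splits a component, and one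
  of its ends can then be added to \<open>S\<close>.\<close>

lemma forest_card_le:
  assumes "forest A" "finite V" "\<forall>e\<in>A. e \<subseteq> V"
    and "S \<subseteq> V" "\<And>x y. x \<in> S \<Longrightarrow> y \<in> S \<Longrightarrow> conn A x y \<Longrightarrow> x = y"
  shows "finite A \<and> card A + card S \<le> card V"
  using assms
proof (induction arbitrary: S)
  case forest_empty
  have "card S \<le> card V" using forest_empty(1,3) by (rule card_mono)
  then show ?case by simp
next
  case (forest_insert A a b)
  let ?A = "insert {a, b} A"
  have mono: "conn ?A x y" if "conn A x y" for x y
    using that by (rule conn_mono) auto
  have ab: "conn ?A a b" by (rule conn_edge) simp
  have finS: "finite S" using forest_insert.prems(3,1) by (rule finite_subset)
  have step: "finite A \<and> card A + card (insert c S) \<le> card V \<and> c \<notin> S"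
    if c: "c \<in> {a, b}" and nc: "\<And>x. x \<in> S \<Longrightarrow> \<not> conn A c x" for c
  proof -
    have 1: "x = y" if xy: "x \<in> insert c S" "y \<in> insert c S" "conn A x y" for x y
    proof -
      consider "x = c" "y = c" | "x = c" "y \<in> S" | "x \<in> S" "y = c" | "x \<in> S" "y \<in> S"
        using xy(1,2) by blast
      then show "x = y"
        using xy(3) nc conn_sym[of A] mono forest_insert.prems(4)[of x y] by cases metis+
    qed
    have 2: "insert c S \<subseteq> V" using c forest_insert.prems(2,3) by auto
    have 3: "\<forall>e\<in>A. e \<subseteq> V" using forest_insert.prems(2) by simp
    have "c \<notin> S" using nc conn_refl by metis
    then show ?thesis
      using forest_insert.IH[OF forest_insert.prems(1) 3 2 1] by blast
  qed
  \<comment> \<open>If both ends reached \<open>S\<close> inside \<open>A\<close>, the new edge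
    would connect the two elements reached; these would coincide and already connect
    \<open>a\<close> with \<open>b\<close>.\<close>
  have "\<exists>c\<in>{a, b}. \<forall>x\<in>S. \<not> conn A c x"
  proof (rule ccontr)
    assume "\<not> ?thesis"
    then obtain x y where xy: "x \<in> S" "conn A a x" "y \<in> S" "conn A b y" by blast
    then have "conn ?A x y" using ab mono conn_sym conn_trans by meson
    then have "x = y" by (rule forest_insert.prems(4)[OF xy(1,3)])
    then have "conn A a b" using xy conn_sym conn_trans by meson
    then show False using forest_insert.hyps by simp
  qed
  then obtain c where "finite A" "card A + card (insert c S) \<le> card V" "c \<notin> S"
    using step by blast
  then show ?case using finS by (simp add: card_insert_if)
qed

lemma forest_colouring:
  assumes "forest A"
  shows "\<exists>\<chi> :: 'a \<Rightarrow> int. (\<forall>x. \<chi> x = 1 \<or> \<chi> x = -1) \<and> (\<forall>x y. {x, y} \<in> A \<longrightarrow> \<chi> y = - \<chi> x)"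
  using assms
proof induction
  case forest_empty
  then show ?case by (intro exI[of _ "\<lambda>_. 1"]) auto
next
  case (forest_insert A a b)
  then obtain \<chi> :: "'a \<Rightarrow> int" where
    \<chi>: "\<And>x. \<chi> x = 1 \<or> \<chi> x = -1" "\<And>x y. {x, y} \<in> A \<Longrightarrow> \<chi> y = - \<chi> x" by blast
  \<comment> \<open>The component of \<open>b\<close> is multiplied by the sign that gives
    \<open>b\<close> the colour opposite to that of \<open>a\<close>.\<close>
  define \<chi>' where "\<chi>' x = (if conn A b x then - \<chi> a * \<chi> b * \<chi> x else \<chi> x)" for x
  have b: "conn A b x \<longleftrightarrow> conn A b y" if "{x, y} \<in> A" for x y
    using conn_edge[OF that] conn_sym conn_trans by meson
  have 1: "\<chi>' x = 1 \<or> \<chi>' x = -1" for x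
    using \<chi>(1)[of a] \<chi>(1)[of b] \<chi>(1)[of x] by (auto simp: \<chi>'_def)
  have 2: "\<chi>' y = - \<chi>' x" if "{x, y} \<in> A" for x y
    using \<chi>(2)[OF that] b[OF that] by (simp add: \<chi>'_def)
  have "\<not> conn A b a" using forest_insert.hyps conn_sym by metis
  then have 3: "\<chi>' b = - \<chi>' a"
    using \<chi>(1)[of b] by (auto simp: \<chi>'_def)
  have "\<chi>' y = - \<chi>' x" if "{x, y} \<in> insert {a, b} A" for x y
  proof (cases "{x, y} \<in> A")
    case False
    then have "x = a \<and> y = b \<or> x = b \<and> y = a" using that by (simp add: doubleton_eq_iff)
    then show ?thesis using 3 by auto
  qed (rule 2)
  with 1 show ?case by blast
qed

lemma pedges_subset: "e \<in> pedges xs \<Longrightarrow> e \<subseteq> set xs"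
  by (induction xs rule: pedges.induct) auto

lemma finite_pedges [simp]: "finite (pedges xs)"
  by (induction xs rule: pedges.induct) auto

lemma pedges_suffix: "pedges (x # zs) \<subseteq> pedges (ys @ x # zs)"
proof (induction ys)
  case (Cons y ys)
  then show ?case by (cases ys) auto
qed auto

lemma conn_path:
  assumes "conn A x y"
  shows "\<exists>xs. distinct xs \<and> pedges xs \<subseteq> A \<and> xs \<noteq> [] \<and> hd xs = x \<and> last xs = y"
proof -
  \<comment> \<open>Induction from the far end \<open>y\<close> builds the list by prefixing
    vertices; a repeated vertex cuts the list back to its earlier occurrence.\<close>
  have "conn A y x" using assms by (rule conn_sym)
  then show ?thesis
  proof (induction rule: conn_induct)
    case refl
    show ?case by (intro exI[of _ "[y]"]) auto
  next
    case (step w z)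
    then obtain xs where xs: "distinct xs" "pedges xs \<subseteq> A" "xs \<noteq> []" "hd xs = w" "last xs = y"
      by blast
    show ?case
    proof (cases "z \<in> set xs")
      case True
      then obtain ys zs where "xs = ys @ z # zs" by (meson split_list)
      then show ?thesis using xs pedges_suffix[of z zs ys]
        by (intro exI[of _ "z # zs"]) auto
    next
      case False
      then show ?thesis using xs step.hyps
        by (intro exI[of _ "z # xs"], cases xs) (auto simp: insert_commute)
    qed
  qed
qed

text \<open>Signs alternate, starting with 1 at \<open>x\<close>, so interior vertices cancel. There
  is one edge more than \<open>length zs\<close>: an even \<open>length zs\<close> means an odd
  number of edges and a positive last edge.\<close>

lemma path_signing:
  assumes "distinct (x # y # zs)"
  shows "\<exists>h. signing (pedges (x # y # zs)) h
    \<and> h {x, y} = 1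
    \<and> (\<forall>v. nsum (pedges (x # y # zs)) h v = of_bool (v = x)
        + (if even (length zs) then 1 else -1) * of_bool (v = last (y # zs)))
    \<and> sum h (pedges (x # y # zs)) = of_bool (even (length zs))"
  using assms
proof (induction zs arbitrary: x y)
  case Nil
  then show ?case by (intro exI[of _ "\<lambda>_. 1"]) (auto simp: signing_def nsum_def)
next
  case (Cons z zs)
  let ?P = "pedges (y # z # zs)"
  have new: "{x, y} \<notin> ?P" using pedges_subset[of "{x, y}" "y # z # zs"] Cons.prems by auto
  obtain h where h: "signing ?P h"
     "\<And>v. nsum ?P h v = of_bool (v = y)
        + (if even (length zs) then 1 else -1) * of_bool (v = last (z # zs))"
     "sum h ?P = of_bool (even (length zs))"
    using Cons.IH[of y z] Cons.prems by auto
  define k where "k = (\<lambda>e. - h e)({x, y} := 1)"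
  have k: "k e = - h e" if "e \<in> ?P" for e using that new by (auto simp: k_def)
  have P: "pedges (x # y # z # zs) = insert {x, y} ?P" by simp
  have "signing (pedges (x # y # z # zs)) k"
    using h(1) k unfolding signing_def P by (auto simp: k_def)
  moreover have "nsum (pedges (x # y # z # zs)) k v = of_bool (v = x)
        + (if even (length (z # zs)) then 1 else -1) * of_bool (v = last (y # z # zs))" for v
  proof -
    have "nsum (pedges (x # y # z # zs)) k v = (if v \<in> {x, y} then 1 else 0) + nsum ?P k v"
      unfolding P using new by (subst nsum_insert) (auto simp: k_def)
    also have "nsum ?P k v = - nsum ?P h v"
      using nsum_cong[of ?P k "\<lambda>e. - h e", OF k] nsum_uminus by simp
    finally have "nsum (pedges (x # y # z # zs)) k v = (if v \<in> {x, y} then 1 else 0)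
        - (of_bool (v = y) + (if even (length zs) then 1 else -1) * of_bool (v = last (z # zs)))"
      by (simp only: h(2))
    moreover have "(if v \<in> {x, y} then 1 else 0) = (of_bool (v = x) + of_bool (v = y) :: int)"
      using Cons.prems by auto
    ultimately show ?thesis by (simp del: pedges.simps)
  qed
  moreover have "sum k (pedges (x # y # z # zs)) = of_bool (even (length (z # zs)))"
  proof -
    have "sum k ?P = - sum h ?P" using k by (simp add: sum_negf[symmetric])
    then have "sum k (pedges (x # y # z # zs)) = 1 - sum h ?P"
      unfolding P using new by (simp add: k_def del: pedges.simps)
    then show ?thesis by (simp add: h(3) del: pedges.simps)
  qed
  moreover have "k {x, y} = 1" by (simp add: k_def)
  ultimately show ?case by blast
qed

text \<open>Alternate along the path of \<open>A\<close> from \<open>x\<close> to \<open>y\<close>.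
  The colours of the two ends determine the parity of its length, hence the sign of its last
  edge.\<close>

lemma forest_path_signing:
  assumes A: "forest A" and xy: "conn A x y" "x \<noteq> y"
    and \<chi>: "\<And>x. \<chi> x = 1 \<or> \<chi> x = (-1::int)" "\<And>x y. {x, y} \<in> A \<Longrightarrow> \<chi> y = - \<chi> x"
  shows "\<exists>S h. S \<subseteq> A \<and> signing S h
    \<and> (\<forall>v. nsum S h v = of_bool (v = x) - \<chi> x * \<chi> y * of_bool (v = y))"
proof -
  obtain xs where xs: "distinct xs" "pedges xs \<subseteq> A" "xs \<noteq> []" "hd xs = x" "last xs = y"
    using conn_path[OF xy(1)] by blast
  then obtain w zs where w: "xs = x # w # zs"
    using xy(2) by (cases xs; cases "tl xs") auto
  have col: "\<chi> (last (b # cs)) = (if even (length cs) then - \<chi> a else \<chi> a)"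
    if "pedges (a # b # cs) \<subseteq> A" for a b cs
    using that
  proof (induction cs arbitrary: a b)
    case Nil
    then show ?case using \<chi>(2) by simp
  next
    case (Cons c cs)
    then have "\<chi> (last (c # cs)) = (if even (length cs) then - \<chi> b else \<chi> b)"
      by (intro Cons.IH) simp
    moreover have "\<chi> b = - \<chi> a" using Cons.prems \<chi>(2) by simp
    ultimately show ?case by simp
  qed
  have "\<chi> x * \<chi> x = 1" using \<chi>(1)[of x] by auto
  moreover have "\<chi> y = (if even (length zs) then - \<chi> x else \<chi> x)"
    using col[of x w zs] xs(2,5) w by simp
  ultimately have eps: "(if even (length zs) then 1 else -1) = - (\<chi> x * \<chi> y)"
    by simp
  obtain h where "signing (pedges xs) h" "\<forall>v. nsum (pedges xs) h v = of_bool (v = x)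
        + (if even (length zs) then 1 else -1) * of_bool (v = y)"
    using path_signing[of x w zs] xs w by auto
  with xs(2) show ?thesis
    unfolding eps by (intro exI[of _ "pedges xs"] exI[of _ h]) simp
qed

subsection \<open>Balanced sets and the decomposition\<close>

text \<open>Double counting: every edge contributes to exactly two vertex sums.\<close>

lemma sum_edge_nsum:
  assumes E: "edges2 E"
  shows "(\<Sum>x\<in>\<Union>E. nsum E f x) = 2 * sum f E"
proof -
  have fin: "finite E" "finite (\<Union>E)"
    using E by (auto simp: edges2_def intro!: finite_Union intro: card_ge_0_finite)
  have "(\<Sum>x\<in>\<Union>E. if x \<in> e then f e else 0) = 2 * f e" if e: "e \<in> E" for e
  proof -
    have "(\<Sum>x\<in>\<Union>E. if x \<in> e then f e else 0) = (\<Sum>x\<in>{x \<in> \<Union>E. x \<in> e}. f e)"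
      using fin(2) by (rule sum.inter_filter[symmetric])
    also have "{x \<in> \<Union>E. x \<in> e} = e" using e by auto
    finally show ?thesis using E e by (simp add: edges2_def)
  qed
  then show ?thesis
    unfolding nsum_def by (subst sum.swap) (simp add: sum_distrib_left)
qed

lemma balanced_sum_0:
  assumes "edges2 B" "balanced B g"
  shows "sum g B = 0"
  using sum_edge_nsum[OF assms(1), of g] assms(2) by (simp add: balanced_def)

lemma balanced_uminus: "balanced B g \<Longrightarrow> balanced B (\<lambda>e. - g e)"
  by (auto simp: balanced_def signing_def nsum_uminus)

lemma balanced_Un:
  assumes "balanced B g" "balanced S h" "finite B" "finite S" "B \<inter> S = {}"
  shows "balanced (B \<union> S) (\<lambda>e. if e \<in> B then g e else h e)"
proof -
  let ?k = "\<lambda>e. if e \<in> B then g e else h e"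
  have "nsum (B \<union> S) ?k x = nsum B g x + nsum S h x" for x
  proof -
    have "nsum B ?k x = nsum B g x" by (rule nsum_cong) simp
    moreover have "nsum S ?k x = nsum S h x" by (rule nsum_cong) (use assms(5) in auto)
    ultimately show ?thesis using nsum_Un[OF assms(3-5)] by simp
  qed
  then show ?thesis using assms(1,2) by (auto simp: balanced_def signing_def)
qed

text \<open>A lone edge of \<open>B\<close> at \<open>x\<close> would leave the vertex sum 1 or
  -1.\<close>

lemma balanced_other_edge:
  assumes B: "finite B" "balanced B g" and e: "e \<in> B" "x \<in> e"
  shows "\<exists>e'\<in>B. e' \<noteq> e \<and> x \<in> e'"
proof (rule ccontr)
  assume no: "\<not> ?thesis"
  have "nsum B g x = (\<Sum>d\<in>{e}. if x \<in> d then g d else 0)"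
    unfolding nsum_def using no e B by (intro sum.mono_neutral_right) auto
  then show False using B e by (auto simp: balanced_def signing_def)
qed

lemma nsum_insert_upd:
  assumes "finite S" "e \<notin> S"
  shows "nsum (insert e S) (h(e := c)) x = (if x \<in> e then c else 0) + nsum S h x"
proof -
  have "nsum S (h(e := c)) x = nsum S h x" by (rule nsum_cong) (use assms in auto)
  then show ?thesis using nsum_insert[OF assms, of "h(e := c)"] by simp
qed

lemma signing_insert_upd:
  "signing S h \<Longrightarrow> c = 1 \<or> c = -1 \<Longrightarrow> signing (insert e S) (h(e := c))"
  by (auto simp: signing_def)

text \<open>Every further edge brings a new leaf. This lets a maximal forest be grown from all
  remaining edges at one vertex.\<close>

lemma forest_star:
  assumes "finite F" "\<And>e. e \<in> F \<Longrightarrow> \<exists>y. e = {u, y} \<and> y \<noteq> u"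
  shows "forest F"
  using assms
proof (induction F)
  case empty
  show ?case by (rule forest_empty)
next
  case (insert e F)
  obtain y where y: "e = {u, y}" "y \<noteq> u" using insert.prems by blast
  have "y \<notin> d" if "d \<in> F" for d
    using insert.prems[of d] insert.hyps that y by auto
  then have "\<not> conn F u y"
    using conn_isolated[of F y u] conn_sym[of F u y] y(2) by metis
  then show ?case unfolding y(1) by (intro forest_insert insert.IH insert.prems) auto
qed

lemma balanced_of_two_chords:
  assumes A: "forest A" "finite A" and xy: "{x, y} \<notin> A" "conn A x y" "x \<noteq> y"
    and xz: "{x, z} \<notin> A" "conn A x z" "x \<noteq> z" and yz: "y \<noteq> z"
  shows "\<exists>S h. S \<noteq> {} \<and> S \<subseteq> insert {x, y} (insert {x, z} A) \<and> balanced S h"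
proof -
  obtain \<chi> :: "'a \<Rightarrow> int" where
    col: "(\<forall>x. \<chi> x = 1 \<or> \<chi> x = -1) \<and> (\<forall>x y. {x, y} \<in> A \<longrightarrow> \<chi> y = - \<chi> x)"
    using forest_colouring[OF A(1)] by (rule exE)
  have \<chi>1: "\<chi> x = 1 \<or> \<chi> x = -1" for x using conjunct1[OF col] by (rule spec)
  have \<chi>2: "\<chi> y = - \<chi> x" if "{x, y} \<in> A" for x y using col that by metis
  have one: "\<exists>S h. S \<noteq> {} \<and> S \<subseteq> insert {x, w} A \<and> balanced S h"
    if w: "{x, w} \<notin> A" "conn A x w" "x \<noteq> w" and ne: "\<chi> x \<noteq> \<chi> w" for w
  proof -
    obtain S h where S: "S \<subseteq> A" "signing S h"
      "\<And>v. nsum S h v = of_bool (v = x) - \<chi> x * \<chi> w * of_bool (v = w)"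
      using forest_path_signing[where \<chi> = \<chi>, OF A(1) w(2,3) \<chi>1 \<chi>2] by metis
    have "\<chi> x * \<chi> w = -1" using \<chi>1[of x] \<chi>1[of w] ne by auto
    then have "nsum S h v = (if v \<in> {x, w} then 1 else 0)" for v using S(3)[of v] w(3) by auto
    moreover have "finite S" using S(1) A(2) by (rule finite_subset)
    moreover have "{x, w} \<notin> S" using S(1) w(1) by blast
    \<comment> \<open>The path has sum 1 at both \<open>x\<close> and \<open>w\<close>; the chord
      with sign -1 cancels both.\<close>
    ultimately have "balanced (insert {x, w} S) (h({x, w} := -1))"
      using S(2) by (simp add: balanced_def signing_insert_upd nsum_insert_upd)
    then show ?thesis using S(1) by (intro exI[of _ "insert {x, w} S"]) auto
  qed
  \<comment> \<open>If one chord joins differently coloured vertices, it closes an even cycle with \<open>A\<close>; otherwise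
    the two chords and an even path of \<open>A\<close> from \<open>y\<close> to \<open>z\<close> form an even closed trail.\<close>
  show ?thesis
  proof (cases "\<chi> x = \<chi> y \<and> \<chi> x = \<chi> z")
    case False
    then show ?thesis using one[OF xy] one[OF xz] by blast
  next
    case True
    have "conn A y z" using xy(2) xz(2) conn_sym conn_trans by meson
    then obtain S h where S: "S \<subseteq> A" "signing S h"
      "\<And>v. nsum S h v = of_bool (v = y) - \<chi> y * \<chi> z * of_bool (v = z)"
      using forest_path_signing[where \<chi> = \<chi>, OF A(1) _ yz \<chi>1 \<chi>2] by metis
    have "\<chi> y * \<chi> z = 1" using \<chi>1[of y] True by auto
    then have n: "nsum S h v = of_bool (v = y) - of_bool (v = z)" for v using S(3)[of v] by simp
    have "finite S" using S(1) A(2) by (rule finite_subset)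
    moreover have "{x, z} \<notin> S" "{x, y} \<notin> S" using S(1) xy(1) xz(1) by blast+
    moreover have "{x, y} \<noteq> {x, z}" using yz by (simp add: doubleton_eq_iff)
    ultimately have f: "finite S" "{x, z} \<notin> S" "{x, y} \<notin> insert {x, z} S" by simp_all
    \<comment> \<open>The path contributes 1 at \<open>y\<close> and -1 at \<open>z\<close>. The
      chord \<open>{x, y}\<close> with -1 and the chord \<open>{x, z}\<close> with 1 cancel these,
      and cancel each other at \<open>x\<close>.\<close>
    have "nsum (insert {x, y} (insert {x, z} S)) ((h({x, z} := 1))({x, y} := -1)) v = 0" for v
    proof -
      have "nsum (insert {x, y} (insert {x, z} S)) ((h({x, z} := 1))({x, y} := -1)) v
          = (if v \<in> {x, y} then -1 else 0) + ((if v \<in> {x, z} then 1 else 0) + nsum S h v)"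
        using nsum_insert_upd[OF _ f(3), of "h({x, z} := 1)" "-1" v]
          nsum_insert_upd[OF f(1,2), of h 1 v] f(1) by simp
      then show ?thesis using yz xy(3) xz(3) by (auto simp: n)
    qed
    then have "balanced (insert {x, y} (insert {x, z} S)) ((h({x, z} := 1))({x, y} := -1))"
      using S(2) by (simp add: balanced_def signing_insert_upd)
    then show ?thesis using S(1) by (intro exI[of _ "insert {x, y} (insert {x, z} S)"]) auto
  qed
qed

text \<open>Of the maximality of \<open>B\<close> and \<open>A\<close> only the consequences are
  recorded: the ends of each edge of \<open>R\<close> are connected in \<open>A\<close>, and
  \<open>R\<close> is a matching.\<close>

definition decomp :: "'a set set \<Rightarrow> 'a set set \<Rightarrow> ('a set \<Rightarrow> int) \<Rightarrow> 'a set set \<Rightarrow> 'a set set \<Rightarrow> bool" where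
  "decomp E B g A R \<longleftrightarrow> E = B \<union> A \<union> R \<and> B \<inter> A = {} \<and> B \<inter> R = {} \<and> A \<inter> R = {}
    \<and> balanced B g \<and> forest A \<and> (\<forall>x y. {x, y} \<in> R \<longrightarrow> conn A x y)
    \<and> (\<forall>x. ndeg R x \<le> 1)"

text \<open>The forest is maximal among those containing the star \<open>U\<close> of all edges at
  \<open>u\<close> outside \<open>B\<close>, which keeps \<open>R\<close> away from
  \<open>u\<close>. Two edges of \<open>R\<close> with a common vertex would contradict the
  maximality of \<open>B\<close>.\<close>

lemma decomp_exists:
  assumes E: "edges2 E"
  shows "\<exists>B g A R. decomp E B g A R \<and> (\<forall>e\<in>R. u \<notin> e)"
proof -
  have finE: "finite E" using E by (rule edges2_finite)
  define \<B> where "\<B> = {B. B \<subseteq> E \<and> (\<exists>g. balanced B g)}"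
  have "finite \<B>" using finE by (simp add: \<B>_def)
  moreover have "{} \<in> \<B>" by (simp add: \<B>_def balanced_def signing_def)
  then have "\<B> \<noteq> {}" by blast
  ultimately obtain B where B: "B \<in> \<B>" and Bmax: "\<forall>C\<in>\<B>. B \<subseteq> C \<longrightarrow> B = C"
    using finite_has_maximal by metis
  from B obtain g where BE: "B \<subseteq> E" and g: "balanced B g" by (auto simp: \<B>_def)
  define H where "H = E - B"
  have finH: "finite H" "finite B" using finE finite_subset[OF BE finE] by (auto simp: H_def)
  \<comment> \<open>By maximality of \<open>B\<close>, the rest \<open>H\<close> contains no
    nonempty balanced set.\<close>
  have noS: "S = {}" if "S \<subseteq> H" "balanced S h" for S h
  proof -
    have "finite S" using that(1) finH finite_subset by blast
    then have "balanced (B \<union> S) (\<lambda>e. if e \<in> B then g e else h e)"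
      using that finH g by (intro balanced_Un) (auto simp: H_def)
    then have "B \<union> S \<in> \<B>" using BE that(1) by (auto simp: H_def \<B>_def)
    then have "B = B \<union> S" using Bmax by blast
    then show "S = {}" using that(1) by (auto simp: H_def)
  qed
  define U where "U = {e \<in> H. u \<in> e}"
  define \<A> where "\<A> = {A. U \<subseteq> A \<and> A \<subseteq> H \<and> forest A}"
  have "forest U"
  proof (rule forest_star[of U u])
    show "finite U" using finH by (simp add: U_def)
    fix e assume "e \<in> U"
    then have "e \<in> E" "u \<in> e" by (auto simp: U_def H_def)
    then show "\<exists>y. e = {u, y} \<and> y \<noteq> u" using edges2D[OF E, of e] by (auto simp: doubleton_eq_iff)
  qed
  then have "U \<in> \<A>" by (auto simp: U_def \<A>_def)
  then have "\<A> \<noteq> {}" by blast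
  moreover have "finite \<A>" using finH by (simp add: \<A>_def)
  ultimately obtain A where "A \<in> \<A>" and Amax: "\<forall>C\<in>\<A>. A \<subseteq> C \<longrightarrow> A = C"
    using finite_has_maximal by metis
  then have A: "U \<subseteq> A" "A \<subseteq> H" "forest A" by (auto simp: \<A>_def)
  have finA: "finite A" using A(2) finH(1) by (rule finite_subset)
  have con: "conn A x y" if "{x, y} \<in> H - A" for x y
  proof (rule ccontr)
    assume "\<not> conn A x y"
    then have "forest (insert {x, y} A)" using A(3) by (intro forest_insert)
    then have "insert {x, y} A \<in> \<A>" using A(1,2) that by (auto simp: \<A>_def)
    then have "A = insert {x, y} A" using Amax by blast
    then show False using that by blast
  qed
  have uniq: "e = e'" if e: "e \<in> H - A" "e' \<in> H - A" and x: "x \<in> e" "x \<in> e'" for e e' x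
  proof (rule ccontr)
    assume ne: "e \<noteq> e'"
    have "e \<in> E" "e' \<in> E" using e by (auto simp: H_def)
    then obtain y z where yz: "e = {x, y}" "x \<noteq> y" "e' = {x, z}" "x \<noteq> z"
      using x edges2D[OF E, of e] edges2D[OF E, of e'] by (auto simp: doubleton_eq_iff)
    then have "y \<noteq> z" using ne by auto
    moreover have "conn A x y" "conn A x z" using con e yz by auto
    moreover have "{x, y} \<notin> A" "{x, z} \<notin> A" using e yz by auto
    ultimately obtain S h where S: "S \<noteq> {}" "S \<subseteq> insert {x, y} (insert {x, z} A)" "balanced S h"
      using balanced_of_two_chords[OF A(3) finA, of x y z] yz(2,4) by blast
    have "S \<subseteq> H" using S(2) e yz A(2) by auto
    then show False using noS[OF _ S(3)] S(1) by blast
  qed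
  have "ndeg (H - A) x \<le> 1" for x
  proof (cases "\<exists>e\<in>H - A. x \<in> e")
    case True
    then obtain e where e: "e \<in> H - A" "x \<in> e" by blast
    have "x \<notin> d" if "d \<in> H - A - {e}" for d using uniq[OF e(1) _ e(2), of d] that by blast
    then have "ndeg (H - A) x = (\<Sum>d\<in>{e}. if x \<in> d then 1 else 0)"
      unfolding nsum_def using e(1) finH by (intro sum.mono_neutral_right) auto
    then show ?thesis by simp
  next
    case False
    then have "ndeg (H - A) x = 0" by (intro nsum_outside) blast
    then show ?thesis by simp
  qed
  then have "decomp E B g A (H - A)"
    using A(2,3) BE g con unfolding decomp_def by (auto simp: H_def)
  moreover have "\<forall>e\<in>H - A. u \<notin> e" using A(1) by (auto simp: U_def)
  ultimately show ?thesis by blast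
qed

definition dsign :: "'a set set \<Rightarrow> ('a set \<Rightarrow> int) \<Rightarrow> 'a set set \<Rightarrow> 'a set \<Rightarrow> int" where
  "dsign B g R e = (if e \<in> B then g e else if e \<in> R then -1 else 1)"

context
  fixes E B A R :: "'a set set" and g :: "'a set \<Rightarrow> int"
  assumes E: "edges2 E" and D: "decomp E B g A R"
begin

lemma decomp_finite: "finite B" "finite A" "finite R"
  using D edges2_finite[OF E] by (auto simp: decomp_def)

lemma signing_dsign: "signing E (dsign B g R)"
  using D by (auto simp: signing_def dsign_def decomp_def balanced_def)

lemma nsum_dsign: "nsum E (dsign B g R) x = ndeg A x - ndeg R x"
proof -
  have "nsum B (dsign B g R) x = 0"
    using D nsum_cong[of B "dsign B g R" g x] by (simp add: dsign_def decomp_def balanced_def)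
  moreover have "nsum A (dsign B g R) x = ndeg A x"
    using D by (intro nsum_cong) (auto simp: dsign_def decomp_def)
  moreover have "nsum R (dsign B g R) x = - ndeg R x"
    unfolding nsum_uminus[symmetric] using D by (intro nsum_cong) (auto simp: dsign_def decomp_def)
  moreover have "nsum E (dsign B g R) x = nsum B (dsign B g R) x + nsum A (dsign B g R) x + nsum R (dsign B g R) x"
    using D decomp_finite by (auto simp: decomp_def nsum_Un Int_Un_distrib2)
  ultimately show ?thesis by simp
qed

lemma sum_dsign: "sum (dsign B g R) E = int (card A) - int (card R)"
proof -
  have "sum (dsign B g R) B = sum g B" by (rule sum.cong) (auto simp: dsign_def)
  also have "\<dots> = 0" using D edges2_subset[OF E] by (intro balanced_sum_0) (auto simp: decomp_def)
  finally have "sum (dsign B g R) B = 0" .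
  moreover have "sum (dsign B g R) A = (\<Sum>e\<in>A. 1)"
    using D by (intro sum.cong) (auto simp: dsign_def decomp_def)
  moreover have "sum (dsign B g R) R = (\<Sum>e\<in>R. -1)"
    using D by (intro sum.cong) (auto simp: dsign_def decomp_def)
  moreover have "sum (dsign B g R) E = sum (dsign B g R) B + sum (dsign B g R) A + sum (dsign B g R) R"
    using D decomp_finite by (auto simp: decomp_def sum.union_disjoint Int_Un_distrib2)
  ultimately show ?thesis by simp
qed

text \<open>An end of an edge of \<open>R\<close> is connected in \<open>A\<close> to the other end,
  so it lies on an edge of \<open>A\<close>. Hence \<open>dsign\<close> has no negative vertex
  sums.\<close>

lemma ndeg_R_le: "ndeg R x \<le> 1 \<and> ndeg R x \<le> ndeg A x"
proof (cases "\<exists>e\<in>R. x \<in> e")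
  case False
  then have "ndeg R x = 0" by (intro nsum_outside) auto
  then show ?thesis using ndeg_nonneg[of A x] by simp
next
  case True
  then obtain e where e: "e \<in> R" "x \<in> e" by blast
  have 1: "ndeg R x \<le> 1" using D by (simp add: decomp_def)
  obtain y where y: "e = {x, y}" "x \<noteq> y"
    using e D edges2D[OF E, of e] by (auto simp: decomp_def doubleton_eq_iff)
  then have "conn A x y" using D e by (auto simp: decomp_def)
  then have "\<exists>d\<in>A. x \<in> d" using conn_isolated[of A x y] y(2) by blast
  then have "ndeg A x \<ge> 1" using ndeg_ge1 decomp_finite by metis
  then show ?thesis using 1 by simp
qed

end

subsection \<open>Flipping alternating trails\<close>

lemma flip1:
  assumes E: "edges2 E" and f: "star_fun E f" and e: "{x, y} \<in> E" "f {x, y} = 1"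
    and x: "nsum E f x \<ge> 3" and y: "nsum E f y \<ge> 3"
  shows "\<exists>f'. star_fun E f' \<and> sum f' E = sum f E - 2"
proof (intro exI conjI)
  let ?f = "f({x, y} := -1)"
  have fin: "finite E" using E by (rule edges2_finite)
  have n: "nsum E ?f v = nsum E f v + (if v \<in> {x, y} then - 2 else 0)" for v
    using nsum_upd[OF fin e(1), of f "-1" v] e(2) by simp
  show "star_fun E ?f"
    unfolding star_fun_def
  proof (intro conjI ballI)
    show "signing E ?f" using f by (auto simp: star_fun_def signing_def)
    fix d v assume "d \<in> E" "v \<in> d"
    then have "nsum E f v \<ge> 1" using f by (auto simp: star_fun_def)
    then show "nsum E ?f v \<ge> 1" unfolding n using x y by auto
  qed
  show "sum ?f E = sum f E - 2" using sum_upd[OF fin e(1), of f "-1"] e(2) by simp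
qed

text \<open>The middle changes cancel at \<open>x\<close> and \<open>y\<close>, so only
  \<open>a\<close> and \<open>b\<close> lose 2 each; a closed trail costs its base point 4, hence
  the bound 5. The conditions \<open>ne\<close> keep the three edges distinct.\<close>

lemma flip3:
  assumes E: "edges2 E" and f: "star_fun E f"
    and e: "{a, x} \<in> E" "f {a, x} = 1" "{x, y} \<in> E" "f {x, y} = -1" "{y, b} \<in> E" "f {y, b} = 1"
    and ne: "a \<noteq> y" "b \<noteq> x"
    and a: "nsum E f a \<ge> 3" and b: "nsum E f b \<ge> 3" and ab: "a = b \<Longrightarrow> nsum E f a \<ge> 5"
  shows "\<exists>f'. star_fun E f' \<and> sum f' E = sum f E - 2"
proof -
  have ne': "a \<noteq> x" "x \<noteq> y" "y \<noteq> b" using e edges2_neq[OF E] by metis+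
  have d: "{x, y} \<noteq> {a, x}" "{y, b} \<noteq> {a, x}" "{y, b} \<noteq> {x, y}"
    using ne ne' by (auto simp: doubleton_eq_iff)
  have fin: "finite E" using E by (rule edges2_finite)
  define g where "g = f({a, x} := -1)"
  define h where "h = g({x, y} := 1)"
  define k where "k = h({y, b} := -1)"
  have gxy: "g {x, y} = -1" unfolding g_def fun_upd_other[OF d(1)] by (rule e(4))
  have "g {y, b} = 1" unfolding g_def fun_upd_other[OF d(2)] by (rule e(6))
  then have hyb: "h {y, b} = 1" unfolding h_def fun_upd_other[OF d(3)] .
  have g: "nsum E g v = nsum E f v - 2 * (of_bool (v = a) + of_bool (v = x))" for v
    unfolding g_def nsum_upd[OF fin e(1)] e(2) using ne'(1) by auto
  have h: "nsum E h v = nsum E g v + 2 * (of_bool (v = x) + of_bool (v = y))" for v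
    unfolding h_def nsum_upd[OF fin e(3)] gxy using ne'(2) by auto
  have k: "nsum E k v = nsum E h v - 2 * (of_bool (v = y) + of_bool (v = b))" for v
    unfolding k_def nsum_upd[OF fin e(5)] hyb using ne'(3) by auto
  have n: "nsum E k v = nsum E f v - 2 * of_bool (v = a) - 2 * of_bool (v = b)" for v
    unfolding k h g by simp
  have "signing E k" using f by (simp add: star_fun_def signing_def g_def h_def k_def)
  moreover have "nsum E k v \<ge> 1" if "d \<in> E" "v \<in> d" for d v
  proof -
    have "nsum E f v \<ge> 1" using f that by (auto simp: star_fun_def)
    then show ?thesis unfolding n using a b ab by (cases "v = a"; cases "v = b") simp_all
  qed
  moreover have "sum k E = sum f E - 2"
    unfolding k_def sum_upd[OF fin e(5)] hyb unfolding h_def sum_upd[OF fin e(3)] gxy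
    unfolding g_def sum_upd[OF fin e(1)] e(2) by simp
  ultimately show ?thesis unfolding star_fun_def by blast
qed

text \<open>From a leaf adjacent to \<open>c\<close> the only edge leads back to \<open>c\<close>,
  so the component of \<open>c\<close> is a star.\<close>

lemma leaf_neighbours_conn:
  assumes A: "finite A" and leaf: "\<And>y. {c, y} \<in> A \<Longrightarrow> ndeg A y \<le> 1" and y: "conn A c y"
  shows "y = c \<or> {c, y} \<in> A"
  using y
proof (induction rule: conn_induct)
  case refl
  show ?case by simp
next
  case (step y z)
  show ?case
  proof (cases "y = c")
    case True
    then show ?thesis using step by simp
  next
    case False
    then have "{c, y} \<in> A" "ndeg A y \<le> 1" using step leaf by auto
    then have "{c, y} = {y, z}" using ndeg_ge2[OF A, of "{c, y}" y "{y, z}"] step(2) by auto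
    then show ?thesis by (auto simp: doubleton_eq_iff)
  qed
qed

text \<open>If \<open>x\<close> has a neighbour of degree at least 2, all neighbours of that vertex
  are leaves and it is the centre; otherwise \<open>x\<close> itself is.\<close>

lemma star_centre:
  assumes A: "finite A" and small: "\<And>x y. {x, y} \<in> A \<Longrightarrow> ndeg A x \<le> 1 \<or> ndeg A y \<le> 1"
  shows "\<exists>c. conn A x c \<and> (\<forall>y. conn A x y \<longrightarrow> y = c \<or> {c, y} \<in> A)"
proof (cases "\<exists>y. {x, y} \<in> A \<and> \<not> ndeg A y \<le> 1")
  case False
  then show ?thesis using leaf_neighbours_conn[OF A, of x] by (intro exI[of _ x]) auto
next
  case True
  then obtain c where c: "{x, c} \<in> A" "\<not> ndeg A c \<le> 1" by blast
  have xc: "conn A x c" using c(1) by (rule conn_edge)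
  have "ndeg A y \<le> 1" if "{c, y} \<in> A" for y using small[OF that] c(2) by simp
  then have "y = c \<or> {c, y} \<in> A" if "conn A x y" for y
    using leaf_neighbours_conn[OF A] conn_trans[OF conn_sym[OF xc] that] by blast
  then show ?thesis using xc by blast
qed

lemma ndeg_ge_neighbours:
  assumes "finite A" "finite S" "\<And>y. y \<in> S \<Longrightarrow> {c, y} \<in> A"
  shows "ndeg A c \<ge> int (card S)"
proof -
  have "inj_on (\<lambda>y. {c, y}) S" by (rule inj_onI) (auto simp: doubleton_eq_iff)
  then have "card ((\<lambda>y. {c, y}) ` S) = card S" by (rule card_image)
  then show ?thesis
    using ndeg_ge_card[of A "(\<lambda>y. {c, y}) ` S" c] assms by auto
qed

lemma balanced_sign:
  assumes "balanced B g" "e \<in> B" "s = 1 \<or> s = -1"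
  shows "\<exists>g'. balanced B g' \<and> g' e = s"
proof (cases "g e = s")
  case True
  then show ?thesis using assms by blast
next
  case False
  then have "- g e = s" using assms by (auto simp: balanced_def signing_def)
  then show ?thesis using balanced_uminus[OF assms(1)] by blast
qed

lemma decomp_cong: "decomp E B g A R \<Longrightarrow> balanced B g' \<Longrightarrow> decomp E B g' A R"
  by (simp add: decomp_def)

subsection \<open>One vertex of even degree\<close>

text \<open>Away from \<open>u\<close> the excess \<open>t\<close> is odd and nonnegative, hence at
  least 1. Only \<open>u\<close> can fail, and only if \<open>A\<close> misses it; since
  \<open>R\<close> avoids \<open>u\<close>, all edges at \<open>u\<close> are then in
  \<open>B\<close>, and turning one of them from -1 to 1 repairs \<open>u\<close> at a cost of
  2.\<close>

lemma star_fun_one_exception: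
  assumes finV: "finite V" and E: "edges2 E" and sub: "\<And>e. e \<in> E \<Longrightarrow> e \<subseteq> V" and u: "u \<in> V"
    and odd: "\<And>x. x \<in> V \<Longrightarrow> x \<noteq> u \<Longrightarrow> odd (ndeg E x)"
  shows "\<exists>f. star_fun E f \<and> sum f E \<le> int (card V) - 1"
proof -
  have finE: "finite E" using E by (rule edges2_finite)
  obtain B g0 A R where D0: "decomp E B g0 A R" and Ru: "\<And>e. e \<in> R \<Longrightarrow> u \<notin> e"
    using decomp_exists[OF E, of u] by blast
  have un: "E = B \<union> A \<union> R" and AB: "A \<inter> B = {}" and AR: "A \<inter> R = {}" and BR: "B \<inter> R = {}"
    and forest: "forest A" and bal: "balanced B g0"
    using D0 by (auto simp: decomp_def)
  have fin: "finite A" "finite B" "finite R" using decomp_finite[OF E D0] by simp_all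
  have Asub: "\<forall>e\<in>A. e \<subseteq> V" using sub un by blast
  define t where "t x = ndeg A x - ndeg R x" for x
  have t0: "t x \<ge> 0" for x using ndeg_R_le[OF E D0, of x] by (simp add: t_def)
  have t1: "t x \<ge> 1 \<and> odd (t x)" if "x \<in> V" "x \<noteq> u" for x
  proof -
    have "odd (t x)"
      using signing_parity[OF finE signing_dsign[OF E D0], of x] nsum_dsign[OF E D0, of x] odd[OF that]
      by (simp add: t_def)
    moreover have "t x \<noteq> 0" using calculation by auto
    ultimately show ?thesis using t0[of x] by linarith
  qed
  have Ru0: "ndeg R u = 0" using Ru by (intro nsum_outside) auto
  have cardA: "card A \<le> card V - 1" "card V \<ge> 1"
    using forest_card_le[OF forest finV Asub, of "{u}"] u by auto
  show ?thesis
  proof (cases "ndeg A u > 0 \<or> (\<forall>e\<in>E. u \<notin> e)")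
    case True
    have "nsum E (dsign B g0 R) x \<ge> 1" if "e \<in> E" "x \<in> e" for e x
    proof (cases "x = u")
      case True
      then have "ndeg A u > 0" using \<open>ndeg A u > 0 \<or> _\<close> that by auto
      then show ?thesis using nsum_dsign[OF E D0] Ru0 True by simp
    next
      case False
      then show ?thesis using t1[of x] sub that nsum_dsign[OF E D0] by (auto simp: t_def)
    qed
    then have "star_fun E (dsign B g0 R)"
      using signing_dsign[OF E D0] by (simp add: star_fun_def)
    moreover have "sum (dsign B g0 R) E \<le> int (card V) - 1"
      using sum_dsign[OF E D0] cardA by simp
    ultimately show ?thesis by blast
  next
    case False
    then have Au: "ndeg A u = 0" using ndeg_nonneg[of A u] by linarith
    then have noA: "u \<notin> e" if "e \<in> A" for e using ndeg_ge1[OF fin(1) that, of u] by auto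
    obtain e where e: "e \<in> E" "u \<in> e" using False by blast
    then have eB: "e \<in> B" using noA Ru un by blast
    obtain z where z: "e = {u, z}" "u \<noteq> z"
      using edges2D[OF E e(1)] e(2) by (auto simp: doubleton_eq_iff)
    have zV: "z \<in> V" using sub e z by auto
    obtain g where g: "balanced B g" "g e = -1" using balanced_sign[OF bal eB, of "-1"] by blast
    have D: "decomp E B g A R" using D0 g(1) by (rule decomp_cong)
    define f where "f = (dsign B g R)(e := 1)"
    have fe: "dsign B g R e = -1" using eB g by (simp add: dsign_def)
    have nf: "nsum E f x = t x + (if x \<in> e then 2 else 0)" for x
      unfolding f_def nsum_upd[OF finE e(1)] fe nsum_dsign[OF E D] t_def by simp
    have sf: "sum f E = int (card A) - int (card R) + 2"
      unfolding f_def sum_upd[OF finE e(1)] fe sum_dsign[OF E D] by simp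
    have star: "star_fun E f"
      unfolding star_fun_def
    proof (intro conjI ballI)
      show "signing E f" using signing_dsign[OF E D] by (simp add: signing_def f_def)
      fix d x assume "d \<in> E" "x \<in> d"
      then have "x \<in> V" using sub by blast
      then show "nsum E f x \<ge> 1" using t1[of x] t0[of x] e(2) by (cases "x = u") (auto simp: nf)
    qed
    have iso: "\<not> conn A u y" if "y \<noteq> u" for y using conn_isolated[of A u y] noA that by blast
    have uz: "x = y" if "x \<in> {u, z}" "y \<in> {u, z}" "conn A x y" for x y
      using that iso conn_sym by (metis insertE singletonD)
    have two: "card A + 2 \<le> card V"
      using forest_card_le[where S = "{u, z}", OF forest finV Asub _ uz] u zV z(2) by simp
    show ?thesis
    \<comment> \<open>The total is too large only if \<open>A\<close> connects all vertices but
      \<open>u\<close> and \<open>R\<close> is empty. Then a flip at \<open>z\<close>, whose sum was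
      raised by 2, has to regain the cost.\<close>
    proof (cases "card A + 2 = card V \<and> card R = 0")
      case False
      then have "sum f E \<le> int (card V) - 1" using two sf by auto
      then show ?thesis using star by blast
    next
      case True
      then have R: "R = {}" using fin by simp
      have con: "conn A z y" if "y \<in> V" "y \<noteq> u" for y
      proof (rule ccontr)
        assume n: "\<not> conn A z y"
        then have "y \<noteq> z" by auto
        have uzy: "a = b" if "a \<in> {u, z, y}" "b \<in> {u, z, y}" "conn A a b" for a b
          using that iso n conn_sym by (metis insertE singletonD)
        show False
          using forest_card_le[where S = "{u, z, y}", OF forest finV Asub _ uzy] u zV that z(2) \<open>y \<noteq> z\<close> True by simp
      qed
      have nz: "nsum E f z \<ge> 3" using t1[OF zV] z by (auto simp: nf)
      show ?thesis
      proof (cases "\<exists>y. {z, y} \<in> A \<and> \<not> ndeg A y \<le> 1")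
        case True
        then obtain y where y: "{z, y} \<in> A" "\<not> ndeg A y \<le> 1" by blast
        have "y \<in> V" using y(1) Asub by blast
        moreover have "y \<noteq> u" using y(1) noA by blast
        ultimately have "odd (t y)" using t1 by blast
        then have "t y \<noteq> 2" by auto
        moreover have "t y \<ge> 2" using y(2) R by (simp add: t_def)
        ultimately have ny: "nsum E f y \<ge> 3" by (simp add: nf)
        have "f {z, y} = 1" using y(1) AB R by (auto simp: f_def dsign_def)
        then obtain f' where "star_fun E f'" "sum f' E = sum f E - 2"
          using flip1[OF E star, of z y] y(1) un nz ny by blast
        then show ?thesis using two sf by (intro exI[of _ f']) auto
      next
        case False
        \<comment> \<open>Here \<open>A\<close> is a star with centre \<open>z\<close> on all
          vertices but \<open>u\<close>, so a second edge of \<open>B\<close> at \<open>z\<close>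
          would also be an edge of \<open>A\<close>.\<close>
        obtain d where d: "d \<in> B" "d \<noteq> e" "z \<in> d"
          using balanced_other_edge[OF fin(2) g(1) eB, of z] z by auto
        then obtain y where y: "d = {z, y}" "z \<noteq> y"
          using edges2D[OF E, of d] un by (auto simp: doubleton_eq_iff)
        have "y \<noteq> u" using d y z by (auto simp: insert_commute)
        moreover have "y \<in> V" using sub d y un by auto
        ultimately have "y = z \<or> {z, y} \<in> A"
          using leaf_neighbours_conn[OF fin(1), of z y] con False by blast
        then show ?thesis using y d AB by blast
      qed
    qed
  qed
qed

subsection \<open>Two vertices of even degree\<close>

lemma pedges_last_edge:
  "distinct xs \<Longrightarrow> 2 \<le> length xs \<Longrightarrow> \<exists>q. {q, last xs} \<in> pedges xs"
proof (induction xs rule: pedges.induct)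
  case (1 x y zs)
  show ?case
  proof (cases zs)
    case Nil
    then show ?thesis by (intro exI[of _ x]) simp
  next
    case (Cons z zs')
    then have "\<exists>q. {q, last (y # zs)} \<in> pedges (y # zs)" using 1 by simp
    then obtain q where "{q, last (y # zs)} \<in> pedges (y # zs)" by (rule exE)
    then show ?thesis by (intro exI[of _ q]) simp
  qed
qed simp_all

text \<open>Take the first step of the walk into \<open>T\<close>. Its outer end \<open>z\<close> is
  either the start or has the preceding vertex of the walk as a further neighbour outside
  \<open>T\<close>.\<close>

lemma conn_enters:
  assumes "conn A w x" "w \<notin> T" "x \<in> T"
  shows "\<exists>z a. z \<notin> T \<and> a \<in> T \<and> {z, a} \<in> A \<and> (z = w \<or> (\<exists>z'. z' \<notin> T \<and> {z', z} \<in> A))"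
proof -
  define Q where "Q z \<longleftrightarrow> z \<notin> T \<and> (z = w \<or> (\<exists>z'. z' \<notin> T \<and> {z', z} \<in> A))" for z
  have "(\<exists>z a. Q z \<and> a \<in> T \<and> {z, a} \<in> A) \<or> Q x"
    using assms(1)
  proof (induction rule: conn_induct)
    case refl
    show ?case using assms(2) by (simp add: Q_def)
  next
    case (step y z)
    have "Q z" if "Q y" "z \<notin> T" using that step(2) unfolding Q_def by blast
    then show ?case using step by blast
  qed
  then obtain z a where "Q z" "a \<in> T" "{z, a} \<in> A" using assms(3) by (auto simp: Q_def)
  then show ?thesis unfolding Q_def by (intro exI[of _ z] exI[of _ a]) simp
qed

text \<open>
  \<open>\<kappa>\<close> counts the repetitions of the positive sign on the path; for \<open>\<kappa> = 1\<close> the repetition is at the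
  second vertex \<open>w\<close> of the path. Note that \<open>length p\<close> counts vertices, so it is even for a path with
  an odd number of edges.
\<close>

locale path_decomp =
  fixes V :: "'a set" and E :: "'a set set" and u v w :: 'a and p :: "'a list"
    and h g :: "'a set \<Rightarrow> int" and \<kappa> :: int and B A R :: "'a set set"
  assumes finV: "finite V" and E: "edges2 E" and sub: "\<And>e. e \<in> E \<Longrightarrow> e \<subseteq> V"
    and uv: "u \<in> V" "v \<in> V" "u \<noteq> v"
    and path: "distinct p" "pedges p \<subseteq> E" "p \<noteq> []" "hd p = u" "last p = v"
    and shortest: "\<And>q. distinct q \<Longrightarrow> pedges q \<subseteq> E \<Longrightarrow> q \<noteq> [] \<Longrightarrow> hd q = u \<Longrightarrow> last q = v
      \<Longrightarrow> length p \<le> length q"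
    and parity: "\<And>x. x \<in> V \<Longrightarrow> odd (ndeg E x) \<longleftrightarrow> x \<noteq> u \<and> x \<noteq> v"
    and h: "signing (pedges p) h"
    and nsum_h: "\<And>x. nsum (pedges p) h x = of_bool (x = u) + of_bool (x = v) + 2 * \<kappa> * of_bool (x = w)"
    and sum_h: "sum h (pedges p) = 1 + \<kappa>"
    and kappa: "\<kappa> = 0 \<and> even (length p) \<or> \<kappa> = 1 \<and> odd (length p) \<and> (\<exists>zs. p = u # w # zs)"
    and D: "decomp (E - pedges p) B g A R"
begin

abbreviation P where "P \<equiv> pedges p"

text \<open>The balanced signing is a parameter because it may be negated later to prescribe the
  sign of one edge of \<open>B\<close>.\<close>

definition psign :: "('a set \<Rightarrow> int) \<Rightarrow> 'a set \<Rightarrow> int" where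
  "psign g' e = (if e \<in> P then h e else dsign B g' R e)"

abbreviation f where "f \<equiv> psign g"

definition good :: bool where
  "good \<longleftrightarrow> (\<exists>k. is_SEDF E k \<and> sum k E \<le> int (card V) - 1)"

lemma EP: "edges2 (E - P)"
  using E by (rule edges2_subset) blast

lemma finE: "finite E"
  using E by (rule edges2_finite)

lemma parts: "E = P \<union> B \<union> A \<union> R" "A \<inter> P = {}" "B \<inter> P = {}" "R \<inter> P = {}" "A \<inter> B = {}" "A \<inter> R = {}" "B \<inter> R = {}"
  using D path(2) unfolding decomp_def by blast+

lemma subs: "A \<subseteq> E" "B \<subseteq> E" "R \<subseteq> E" "P \<subseteq> E"
  using parts(1) by blast+

lemma fins: "finite A" "finite B" "finite R"
  using finite_subset[OF subs(1) finE] finite_subset[OF subs(2) finE] finite_subset[OF subs(3) finE] by simp_all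

lemma bal: "balanced B g"
  using D by (simp add: decomp_def)

lemma forestA: "forest A"
  using D by (simp add: decomp_def)

lemma edge_V: "{x, y} \<in> E \<Longrightarrow> x \<in> V \<and> y \<in> V \<and> x \<noteq> y"
  using sub edges2_neq[OF E] by blast

lemma psign_props:
  assumes g': "balanced B g'"
  shows "signing E (psign g')"
    and "nsum E (psign g') x = ndeg A x - ndeg R x + nsum P h x"
    and "sum (psign g') E = int (card A) - int (card R) + 1 + \<kappa>"
proof -
  have D': "decomp (E - P) B g' A R" using D g' by (rule decomp_cong)
  have EU: "E = P \<union> (E - P)" using path(2) by blast
  have fin: "finite P" "finite (E - P)" "P \<inter> (E - P) = {}" using finE by auto
  have c1: "psign g' e = h e" if "e \<in> P" for e using that by (simp add: psign_def)
  have c2: "psign g' e = dsign B g' R e" if "e \<in> E - P" for e using that by (simp add: psign_def)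
  show "signing E (psign g')"
    using h signing_dsign[OF EP D'] unfolding signing_def psign_def by auto
  have "nsum E (psign g') x = nsum P (psign g') x + nsum (E - P) (psign g') x"
    using nsum_Un[OF fin, of "psign g'" x] EU by simp
  also have "\<dots> = nsum P h x + nsum (E - P) (dsign B g' R) x"
    using nsum_cong[of P "psign g'" h, OF c1] nsum_cong[of "E - P" "psign g'" "dsign B g' R", OF c2]
    by simp
  finally show "nsum E (psign g') x = ndeg A x - ndeg R x + nsum P h x"
    using nsum_dsign[OF EP D', of x] by simp
  have "sum (psign g') E = sum (psign g') P + sum (psign g') (E - P)"
    using sum.union_disjoint[OF fin, of "psign g'"] EU by simp
  also have "\<dots> = sum h P + sum (dsign B g' R) (E - P)"
  proof -
    have "sum (psign g') P = sum h P" by (rule sum.cong[OF refl c1])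
    moreover have "sum (psign g') (E - P) = sum (dsign B g' R) (E - P)" by (rule sum.cong[OF refl c2])
    ultimately show ?thesis by simp
  qed
  finally show "sum (psign g') E = int (card A) - int (card R) + 1 + \<kappa>"
    using sum_dsign[OF EP D'] sum_h by simp
qed

lemma signing_f: "signing E f" and
  nsum_f: "nsum E f x = ndeg A x - ndeg R x + of_bool (x = u) + of_bool (x = v) + 2 * \<kappa> * of_bool (x = w)" and
  sum_f: "sum f E = int (card A) - int (card R) + 1 + \<kappa>"
  using psign_props[OF bal] nsum_h by simp_all

lemma kappa_ge: "\<kappa> \<ge> 0"
  using kappa by auto

text \<open>Removing the path changes the parity of the degree exactly at \<open>u\<close> and
  \<open>v\<close>, so all vertices of \<open>V\<close> have odd degree in the rest.\<close>

lemma excess: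
  assumes "x \<in> V"
  shows "ndeg A x - ndeg R x \<ge> 1" "odd (ndeg A x - ndeg R x)"
proof -
  have "even (nsum E f x) \<longleftrightarrow> even (ndeg E x)" using signing_parity[OF finE signing_f] .
  then show o: "odd (ndeg A x - ndeg R x)"
    using parity[OF assms] nsum_f[of x] uv(3) by (cases "x = u"; cases "x = v") auto
  have "ndeg A x - ndeg R x \<ge> 0" using ndeg_R_le[OF EP D, of x] by simp
  moreover have "ndeg A x - ndeg R x \<noteq> 0" using o by auto
  ultimately show "ndeg A x - ndeg R x \<ge> 1" by linarith
qed

lemma nsum_f_ge: "ndeg A x - ndeg R x \<le> nsum E f x"
  using nsum_f[of x] kappa_ge by auto

lemma nsum_f_w: "\<kappa> = 1 \<Longrightarrow> ndeg A w - ndeg R w + 2 \<le> nsum E f w"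
  using nsum_f[of w] by auto

lemma star_f:
  assumes "balanced B g'"
  shows "star_fun E (psign g')"
  unfolding star_fun_def
proof (intro conjI ballI)
  show "signing E (psign g')" using psign_props(1)[OF assms] .
  fix e x assume "e \<in> E" "x \<in> e"
  then have "x \<in> V" using sub by blast
  then show "nsum E (psign g') x \<ge> 1"
    using excess(1)[of x] nsum_f_ge[of x] psign_props(2)[OF assms, of x] psign_props(2)[OF bal, of x]
    by linarith
qed

text \<open>Negating \<open>g\<close> if necessary leaves all vertex sums alone, so an edge of
  \<open>B\<close> can serve as a positive or as a negative edge of a flip.\<close>

lemma signed_base:
  assumes "e \<in> B" "s = 1 \<or> s = -1"
  shows "\<exists>k. star_fun E k \<and> k e = s \<and> (\<forall>d\<in>A. k d = 1) \<and> (\<forall>d\<in>P. k d = h d)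
    \<and> (\<forall>x. nsum E k x = nsum E f x) \<and> sum k E = sum f E"
proof -
  obtain g' where g': "balanced B g'" "g' e = s" using balanced_sign[OF bal assms] by blast
  have "psign g' e = s" using assms(1) g'(2) parts by (auto simp: psign_def dsign_def)
  moreover have "\<forall>d\<in>A. psign g' d = 1" using parts by (auto simp: psign_def dsign_def)
  moreover have "\<forall>d\<in>P. psign g' d = h d" by (simp add: psign_def)
  moreover have "\<forall>x. nsum E (psign g') x = nsum E f x"
    using psign_props(2)[OF g'(1)] psign_props(2)[OF bal] by simp
  moreover have "sum (psign g') E = sum f E"
    using psign_props(3)[OF g'(1)] psign_props(3)[OF bal] by simp
  ultimately show ?thesis using star_f[OF g'(1)] by blast
qed

lemma f_A: "e \<in> A \<Longrightarrow> f e = 1"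
  using parts by (auto simp: psign_def dsign_def)

lemma f_R: "e \<in> R \<Longrightarrow> f e = -1"
  using parts by (auto simp: psign_def dsign_def)

lemma goodI: "star_fun E k \<Longrightarrow> sum k E \<le> int (card V) - 1 \<Longrightarrow> good"
  using star_fun_is_SEDF[OF E] good_def by blast

lemma good_improve:
  assumes "\<exists>k'. star_fun E k' \<and> sum k' E = sum k E - 2" "sum k E \<le> int (card V) + 1"
  shows good
proof -
  obtain k' where k': "star_fun E k'" "sum k' E = sum k E - 2" using assms(1) by blast
  show ?thesis using k'(2) assms(2) by (intro goodI[OF k'(1)]) simp
qed

lemma good_edge:
  assumes "{x, y} \<in> A" "nsum E f x \<ge> 3" "nsum E f y \<ge> 3" "sum f E \<le> int (card V) + 1"
  shows good
  using flip1[OF E star_f[OF bal], of x y] assms f_A subs by (intro good_improve[of f]) auto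

lemma excess_ge3:
  assumes "x \<in> V" "ndeg R x = 0" "ndeg A x \<ge> 2"
  shows "ndeg A x \<ge> 3"
proof -
  have "ndeg A x \<noteq> 2" using excess(2)[OF assms(1)] assms(2) by auto
  then show ?thesis using assms(3) by linarith
qed

lemma nsum_f_ge3:
  assumes "x \<in> V" "ndeg R x = 0" "ndeg A x \<ge> 2"
  shows "nsum E f x \<ge> 3"
  using excess_ge3[OF assms] nsum_f_ge[of x] assms(2) by linarith

lemma A_sub_V: "\<forall>e\<in>A. e \<subseteq> V"
  using sub subs by blast

lemma card_A: "card A + 1 \<le> card V"
  using forest_card_le[where S = "{u}", OF forestA finV A_sub_V] uv(1) by simp

lemma conn_V:
  assumes "conn A x y" "x \<in> V"
  shows "y \<in> V"
  using assms(1)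
proof (induction rule: conn_induct)
  case refl
  show ?case by (rule assms(2))
next
  case (step y z)
  then show ?case using edge_V[of y z] subs(1) by blast
qed

lemma conn_two:
  assumes "card A + 1 = card V" "x \<in> V" "y \<in> V"
  shows "conn A x y"
proof (rule ccontr)
  assume n: "\<not> conn A x y"
  then have ne: "x \<noteq> y" by auto
  have inj: "a = b" if "a \<in> {x, y}" "b \<in> {x, y}" "conn A a b" for a b
    using that n conn_sym by (metis insertE singletonD)
  show False
    using forest_card_le[where S = "{x, y}", OF forestA finV A_sub_V _ inj] assms ne by simp
qed

text \<open>\<open>A\<close> has only two components, and \<open>y\<close> and \<open>z\<close> both
  lie in the one without \<open>x\<close>.\<close>

lemma conn_three:
  assumes "card A + 2 = card V" "x \<in> V" "y \<in> V" "z \<in> V" "\<not> conn A x y" "\<not> conn A x z"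
  shows "conn A y z"
proof (rule ccontr)
  assume n: "\<not> conn A y z"
  have ne: "x \<noteq> y" "x \<noteq> z" "y \<noteq> z" using assms(5,6) n by auto
  have inj: "a = b" if "a \<in> {x, y, z}" "b \<in> {x, y, z}" "conn A a b" for a b
    using that n assms(5,6) conn_sym by (metis insertE singletonD)
  show False
    using forest_card_le[where S = "{x, y, z}", OF forestA finV A_sub_V _ inj] assms(1-4) ne by simp
qed

lemma path_len2:
  assumes "{u, v} \<in> E"
  shows "length p = 2"
proof -
  have "length p \<le> 2" using shortest[of "[u, v]"] assms uv(3) by simp
  moreover have "length p \<noteq> 1" using path(4,5) uv(3) by (cases p) auto
  ultimately show ?thesis using path(3) by (cases p; cases "tl p") auto
qed

lemma path_len3:
  assumes "{u, c} \<in> E" "{c, v} \<in> E"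
  shows "length p \<le> 3"
proof -
  have "u \<noteq> c" "c \<noteq> v" using edge_V assms by blast+
  then show ?thesis using shortest[of "[u, c, v]"] assms uv(3) by simp
qed

lemma path_cons: "\<exists>q zs. p = u # q # zs"
  using path(3-5) uv(3) by (cases p; cases "tl p") auto

lemma u_in_P: "\<exists>q. {u, q} \<in> P"
proof -
  obtain q zs where "p = u # q # zs" using path_cons by blast
  then show ?thesis by auto
qed

lemma v_in_P: "\<exists>q. {q, v} \<in> P"
proof -
  obtain q zs where "p = u # q # zs" using path_cons by blast
  then have "2 \<le> length p" by simp
  then show ?thesis using pedges_last_edge[OF path(1)] path(5) by metis
qed

text \<open>An edge of \<open>A\<close> between two vertices of larger degree could be flipped,
  because odd excess raises a degree of 2 to 3. With \<open>star_centre\<close>, \<open>A\<close>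
  therefore consists of stars.\<close>

lemma small_ends:
  assumes "R = {}" "\<not> good" "sum f E \<le> int (card V) + 1" "{x, y} \<in> A"
  shows "ndeg A x \<le> 1 \<or> ndeg A y \<le> 1"
proof (rule ccontr)
  assume "\<not> ?thesis"
  moreover have "x \<in> V" "y \<in> V" using edge_V subs assms(4) by blast+
  ultimately have "nsum E f x \<ge> 3" "nsum E f y \<ge> 3" using nsum_f_ge3 assms(1) by auto
  then show False using good_edge assms by blast
qed

section \<open>Extremal case for a path with an odd number of edges\<close>

text \<open>\<open>A\<close> is a spanning star whose centre \<open>c\<close> lies off the path. As
  \<open>u, c, v\<close> is a path too, the shortest one is the edge \<open>{u, v}\<close>. Any edge
  of \<open>B\<close> joins two leaves and gives a closed trail through \<open>c\<close>; if
  \<open>B\<close> is empty, the graph is the star plus \<open>{u, v}\<close>.\<close>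

lemma good_odd_spanning:
  assumes k0: "\<kappa> = 0" and card: "card A + 1 = card V" and R: "R = {}"
  shows good
proof (rule ccontr)
  assume ng: "\<not> good"
  have sum: "sum f E = int (card V)" using sum_f k0 card R by simp
  have small: "ndeg A x \<le> 1 \<or> ndeg A y \<le> 1" if "{x, y} \<in> A" for x y
    using small_ends[OF R ng _ that] sum by simp
  obtain c where c: "conn A u c" "\<And>y. conn A u y \<Longrightarrow> y = c \<or> {c, y} \<in> A"
    using star_centre[OF fins(1) small, of u] by blast
  have cV: "c \<in> V" using conn_V[OF c(1)] uv by simp
  have cA: "{c, y} \<in> A" if "y \<in> V" "y \<noteq> c" for y
    using c(2)[OF conn_two[OF card uv(1) that(1)]] that(2) by blast
  have cP: "{c, y} \<notin> P" for y
  proof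
    assume P: "{c, y} \<in> P"
    then have "y \<in> V" "y \<noteq> c" using subs(4) edge_V[of c y] by auto
    then show False using cA P parts(2) by blast
  qed
  have cu: "c \<noteq> u" using cP u_in_P by blast
  have cv: "c \<noteq> v" using cP v_in_P by (metis insert_commute)
  have ucA: "{c, u} \<in> A" "{c, v} \<in> A" using cA uv cu cv by auto
  have "{u, c} \<in> E" "{c, v} \<in> E" using ucA subs(1) by (auto simp: insert_commute)
  then have "length p \<le> 3" by (rule path_len3)
  moreover have "even (length p)" using kappa k0 by auto
  ultimately have "length p \<le> 2" by presburger
  then obtain q where "p = [u, q]" using path_cons by auto
  then have P: "P = {{u, v}}" using path(5) by simp
  have nc: "nsum E f c = ndeg A c" using nsum_f[of c] cu cv k0 R by simp
  have "ndeg A c \<ge> 2" using ndeg_ge2[OF fins(1) ucA(1) _ ucA(2), of c] uv(3) by (auto simp: doubleton_eq_iff)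
  then have c3: "ndeg A c \<ge> 3" using excess_ge3[OF cV] R by simp
  show False
  proof (cases "B = {}")
    case True
    then have EA: "E = insert {u, v} A" using parts(1) P R by blast
    have uvE: "{u, v} \<in> E" using EA by simp
    have "nsum P h u = 1" using nsum_h[of u] uv(3) k0 by simp
    then have "h {u, v} = 1" using P by (simp add: nsum_def)
    then have fuv: "f {u, v} = 1" using P by (simp add: psign_def)
    \<comment> \<open>The sums at \<open>u\<close> and \<open>v\<close> may drop to 0. The edge
      \<open>{u, v}\<close> tolerates this through its own sign -1; every other edge at
      \<open>u\<close> or \<open>v\<close> has, by \<open>end2\<close>, an end with sum at least
      2.\<close>
    define k where "k = f({u, v} := -1)"
    have nk: "nsum E k x = ndeg A x - of_bool (x = u) - of_bool (x = v)" for x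
      unfolding k_def nsum_upd[OF finE uvE] fuv nsum_f using R k0 uv(3) by auto
    have sk: "sum k E = int (card V) - 2"
      unfolding k_def sum_upd[OF finE uvE] fuv sum by simp
    have ge: "nsum E k x \<ge> (if x = u \<or> x = v then 0 else 1)" if "x \<in> V" for x
      using excess(1)[OF that] nk[of x] R uv(3) by (auto split: if_splits)
    have end2: "nsum E k y \<ge> 2 \<or> nsum E k x \<ge> 2" if xy: "{x, y} \<in> A" "x = u \<or> x = v" for x y
    proof (cases "y = c")
      case True
      then show ?thesis using nk[of c] c3 cu cv by simp
    next
      case False
      have x: "x \<in> V" "y \<in> V" "{c, x} \<in> A" using xy ucA uv edge_V[of x y] subs(1) by auto
      have "c \<noteq> y" "x \<noteq> c" using False xy(2) cu cv by auto
      then have "ndeg A x \<ge> 2"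
        using ndeg_ge2[OF fins(1) x(3) _ xy(1), of x] by (auto simp: doubleton_eq_iff)
      then have "ndeg A x \<ge> 3" using excess_ge3[OF x(1)] R by simp
      then show ?thesis using nk[of x] uv(3) xy(2) by auto
    qed
    have "is_SEDF E k"
    proof (rule is_SEDF_I[OF E])
      show sg: "signing E k" using signing_f by (auto simp: k_def signing_def)
      fix x y assume xy: "{x, y} \<in> E" "x \<noteq> y"
      have V: "x \<in> V" "y \<in> V" using edge_V[OF xy(1)] by auto
      show "nsum E k x + nsum E k y - k {x, y} \<ge> 1"
      proof (cases "{x, y} = {u, v}")
        case True
        then have "k {x, y} = -1" by (simp add: k_def)
        then show ?thesis using ge[OF V(1)] ge[OF V(2)] by (auto split: if_splits)
      next
        case False
        then have A: "{x, y} \<in> A" "{y, x} \<in> A" using xy EA by (auto simp: insert_commute)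
        have k1: "k {x, y} \<le> 1" using sg xy(1) by (auto simp: signing_def)
        show ?thesis
          using end2[OF A(1)] end2[OF A(2)] ge[OF V(1)] ge[OF V(2)] k1 by (auto split: if_splits)
      qed
    qed
    then show False using ng sk by (auto simp: good_def)
  next
    case False
    then obtain e where e: "e \<in> B" by blast
    obtain k where k: "star_fun E k" "k e = -1" "\<forall>d\<in>A. k d = 1" "\<forall>x. nsum E k x = nsum E f x"
      "sum k E = sum f E"
      using signed_base[OF e, of "-1"] by blast
    have eE: "e \<in> E" using e subs(2) by blast
    obtain x y where xy: "e = {x, y}" "x \<noteq> y" using edges2D[OF E eE] by blast
    have cB: "b \<noteq> c" if "{a, b} \<in> B" for a b
    proof
      assume "b = c"
      then have "{c, a} \<in> B" using that by (simp add: insert_commute)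
      moreover have "a \<in> V" "a \<noteq> c" using that edge_V[of a b] subs(2) \<open>b = c\<close> by blast+
      ultimately show False using cA parts(5) by blast
    qed
    have other: "\<exists>b'. {a, b'} \<in> B \<and> b' \<noteq> b \<and> b' \<noteq> a" if ab: "{a, b} \<in> B" for a b
    proof -
      obtain d where d: "d \<in> B" "d \<noteq> {a, b}" "a \<in> d"
        using balanced_other_edge[OF fins(2) bal ab, of a] by blast
      obtain b' where "d = {a, b'}" "a \<noteq> b'"
        using edges2D[OF E, of d] d(1,3) subs(2) by (auto simp: doubleton_eq_iff)
      then show ?thesis using d by (intro exI[of _ b']) auto
    qed
    have xyB: "{x, y} \<in> B" "{y, x} \<in> B" using e xy by (simp_all add: insert_commute)
    have ne: "x \<noteq> c" "y \<noteq> c" using cB xyB by blast+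
    have V: "x \<in> V" "y \<in> V" using edge_V[of x y] xyB(1) subs(2) by blast+
    \<comment> \<open>Balancedness forces a further edge of \<open>B\<close> at \<open>x\<close> and
      one at \<open>y\<close>; both lead to leaves other than \<open>x\<close> and
      \<open>y\<close>.\<close>
    obtain y' where y': "{x, y'} \<in> B" "y' \<noteq> y" "y' \<noteq> x" using other[OF xyB(1)] by blast
    obtain y'' where y'': "{y, y''} \<in> B" "y'' \<noteq> x" "y'' \<noteq> y" using other[OF xyB(2)] by blast
    have V': "y' \<in> V" "y'' \<in> V" "y' \<noteq> c" "y'' \<noteq> c"
      using edge_V[of x y'] edge_V[of y y''] y'(1) y''(1) subs(2) cB by blast+
    \<comment> \<open>Otherwise \<open>n = 4\<close> and \<open>B\<close> contains a triangle on the three leaves, but \<open>uv\<close> lies on the path.\<close>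
    have c5: "ndeg A c \<ge> 5"
    proof (rule ccontr)
      assume "\<not> ndeg A c \<ge> 5"
      moreover have "odd (ndeg A c)" using excess(2)[OF cV] R by simp
      then have "ndeg A c \<noteq> 4" by auto
      ultimately have le3: "ndeg A c \<le> 3" by linarith
      have sub3: "S \<subseteq> {x, y, y'}" if S: "finite S" "{x, y, y'} \<subseteq> S" "\<And>z. z \<in> S \<Longrightarrow> z \<in> V \<and> z \<noteq> c" for S
      proof -
        have "ndeg A c \<ge> int (card S)" using ndeg_ge_neighbours[OF fins(1) S(1)] cA S(3) by blast
        then have "card S \<le> card {x, y, y'}" using le3 xy(2) y'(2,3) by auto
        then show ?thesis using card_seteq[OF S(1,2)] by simp
      qed
      have "{u, v, y''} \<subseteq> {x, y, y'}"
        using sub3[of "{u, v, y'', x, y, y'}"] uv cu cv V V' ne by auto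
      moreover have "{u, v} \<notin> B" using P parts(3) by blast
      ultimately show False
        using xyB y'(1) y'' uv(3) by (auto simp: insert_commute)
    qed
    \<comment> \<open>The trail \<open>c, x, y, c\<close> is closed, so the centre loses 4.\<close>
    have "\<exists>k'. star_fun E k' \<and> sum k' E = sum k E - 2"
    proof (rule flip3[OF E k(1), of c x y c])
      show "{c, x} \<in> E" "{y, c} \<in> E" "{x, y} \<in> E"
        using cA[OF V(1) ne(1)] cA[OF V(2) ne(2)] subs xyB by (auto simp: insert_commute)
      show "k {c, x} = 1" "k {y, c} = 1" "k {x, y} = -1"
        using cA[OF V(1) ne(1)] cA[OF V(2) ne(2)] k xy by (auto simp: insert_commute)
    qed (use ne nc c5 k in auto)
    then show False using good_improve[of k] k(5) sum ng by simp
  qed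
qed

section \<open>Extremal cases for a path with an even number of edges\<close>

lemma kappa1:
  assumes "\<kappa> = 1"
  shows "{u, w} \<in> P" "w \<in> V" "w \<noteq> u" "w \<noteq> v" "length p \<ge> 3" "odd (length p)"
proof -
  obtain zs where zs: "p = u # w # zs" using kappa assms by auto
  show "{u, w} \<in> P" using zs by simp
  then show "w \<in> V" using edge_V[of u w] subs(4) by blast
  show "w \<noteq> u" using zs path(1) by auto
  show o: "odd (length p)" using kappa assms by auto
  then have "zs \<noteq> []" using zs by auto
  then show "length p \<ge> 3" using zs by (cases zs) auto
  have "v \<in> set zs" using \<open>zs \<noteq> []\<close> zs path(5) by auto
  then show "w \<noteq> v" using zs path(1) by auto
qed

text \<open>The repeated positive sign gives \<open>w\<close> a sum of at least 3, so a neighbour in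
  \<open>A\<close> that is not a leaf would allow a flip. The component of \<open>w\<close> is thus
  a star with centre \<open>w\<close>.\<close>

lemma w_neighbours:
  assumes k1: "\<kappa> = 1" and R: "R = {}" and ng: "\<not> good" and sum: "sum f E \<le> int (card V) + 1"
    and y: "conn A w y"
  shows "y = w \<or> {w, y} \<in> A"
proof (rule leaf_neighbours_conn[OF fins(1) _ y])
  fix z assume z: "{w, z} \<in> A"
  have V: "w \<in> V" "z \<in> V" using z edge_V[of w z] subs(1) by blast+
  have "nsum E f w \<ge> 3" using nsum_f_w[OF k1] excess(1)[OF V(1)] by linarith
  then have "\<not> nsum E f z \<ge> 3" using good_edge[OF z] ng sum by blast
  then show "ndeg A z \<le> 1" using nsum_f_ge3[OF V(2)] R by force
qed

text \<open>A spanning star with centre \<open>w\<close> would contain \<open>{u, w}\<close>, which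
  is an edge of the path.\<close>

lemma good_even_spanning:
  assumes k1: "\<kappa> = 1" and card: "card A + 1 = card V" and R: "R = {}"
  shows good
proof (rule ccontr)
  assume ng: "\<not> good"
  have sum: "sum f E \<le> int (card V) + 1" using sum_f k1 card R by simp
  have "u = w \<or> {w, u} \<in> A"
    using w_neighbours[OF k1 R ng sum conn_two[OF card kappa1(2)[OF k1] uv(1)]] .
  then show False using kappa1(1,3)[OF k1] parts(2) by (auto simp: insert_commute)
qed

text \<open>Vertices off the chord with two tree edges have sum at least 3. They and
  \<open>w\<close> serve as ends of a flip, if necessary with the chord as negative middle
  edge.\<close>

lemma good_even_chord:
  assumes k1: "\<kappa> = 1" and card: "card A + 1 = card V" and R: "R = {{x, y}}"
  shows good
proof -
  have sum: "sum f E \<le> int (card V) + 1" using sum_f k1 card R by simp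
  have xyE: "{x, y} \<in> E" using R subs(3) by blast
  have V: "x \<in> V" "y \<in> V" "x \<noteq> y" using edge_V[OF xyE] by auto
  have xyA: "{x, y} \<notin> A" "{y, x} \<notin> A" using R parts(6) by (auto simp: insert_commute)
  have R0: "ndeg R z = 0" if "z \<noteq> x" "z \<noteq> y" for z using that R by (simp add: nsum_def)
  have ge3: "nsum E f z \<ge> 3" if "z \<noteq> x" "z \<noteq> y" "z \<in> V" "e \<in> A" "z \<in> e" "e' \<in> A" "z \<in> e'" "e \<noteq> e'" for z e e'
    using nsum_f_ge3[OF that(3) R0[OF that(1,2)] ndeg_ge2[OF fins(1) that(4-8)]] .
  have w3: "nsum E f w \<ge> 3"
    using nsum_f_w[OF k1] excess(1)[OF kappa1(2)[OF k1]] by linarith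
  \<comment> \<open>Interior vertices of the tree path from \<open>x\<close> to \<open>y\<close>
    have sum at least 3. Two adjacent ones allow a flip; otherwise the path is
    \<open>x, q, y\<close>.\<close>
  obtain qs where qs: "distinct qs" "pedges qs \<subseteq> A" "qs \<noteq> []" "hd qs = x" "last qs = y"
    using conn_path[OF conn_two[OF card V(1,2)]] by blast
  obtain q r where q: "qs = x # q # r" using qs(3-5) V(3) by (cases qs; cases "tl qs") auto
  have xq: "{x, q} \<in> A" using qs(2) q by simp
  have qV: "q \<in> V" "q \<noteq> x" using edge_V[of x q] xq subs(1) by blast+
  have "r \<noteq> []" using xyA(1) xq qs(5) q by auto
  then obtain q2 r2 where r: "r = q2 # r2" by (cases r) auto
  have qq2: "{q, q2} \<in> A" using qs(2) q r by simp
  have "y \<in> set r" using qs(5) q \<open>r \<noteq> []\<close> by auto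
  then have qy: "q \<noteq> y" using qs(1) q by auto
  have xq2: "x \<noteq> q2" using qs(1) q r by auto
  have q3: "nsum E f q \<ge> 3" using ge3[of q "{x, q}" "{q, q2}"] qV qy xq qq2 xq2 by (auto simp: doubleton_eq_iff)
  show good
  proof (cases "r2 = []")
    case False
    then obtain q3 r3 where r2: "r2 = q3 # r3" by (cases r2) auto
    have e: "{q2, q3} \<in> A" using qs(2) q r r2 by simp
    have "y \<in> set r2" using qs(5) q r False by auto
    then have "q2 \<noteq> y" using qs(1) q r by auto
    moreover have "q \<noteq> q3" using qs(1) q r r2 by auto
    moreover have "q2 \<in> V" using edge_V[of q q2] qq2 subs(1) by blast
    ultimately have "nsum E f q2 \<ge> 3"
      using ge3[of q2 "{q, q2}" "{q2, q3}"] xq2 qq2 e by (auto simp: doubleton_eq_iff)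
    then show ?thesis using good_edge[OF qq2 q3] sum by blast
  next
    case True
    then have yq: "{y, q} \<in> A" using qq2 qs(5) q r by (simp add: insert_commute)
    have A': "{q, x} \<in> A" "{q, y} \<in> A" using xq yq by (simp_all add: insert_commute)
    have fxy: "f {x, y} = -1" "f {y, x} = -1" using f_R R by (simp_all add: insert_commute)
    have yxE: "{y, x} \<in> E" using xyE by (simp add: insert_commute)
    have star: "star_fun E f" using star_f[OF bal] .
    consider "w = x" | "w = y" | "w = q" | "w \<notin> {x, y, q}" by blast
    then show ?thesis
    proof cases
      case 1
      then show ?thesis using good_edge[OF xq _ q3] w3 sum by blast
    next
      case 2
      then show ?thesis using good_edge[OF yq _ q3] w3 sum by blast
    next
      case 3
      \<comment> \<open>The closed trail \<open>q, x, y, q\<close> requires 5 at \<open>q\<close>: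
        an odd degree of at least 3 in \<open>A\<close>, plus 2 because \<open>q\<close> is
        \<open>w\<close>.\<close>
      have "ndeg A q \<ge> 2" using ndeg_ge2[OF fins(1) xq _ yq, of q] V(3) by (auto simp: doubleton_eq_iff)
      then have "ndeg A q \<ge> 3" using excess_ge3[OF qV(1) R0] qV(2) qy by blast
      then have "nsum E f q \<ge> 5" using nsum_f_w[OF k1] R0[of q] qV(2) qy 3 by simp
      then have "\<exists>k'. star_fun E k' \<and> sum k' E = sum f E - 2"
        using A' xq yq xyE subs(1) fxy f_A qV(2) qy by (intro flip3[OF E star, of q x y q]) auto
      then show ?thesis using good_improve sum by blast
    next
      case 4
      have "conn A w q" using conn_two[OF card kappa1(2)[OF k1] qV(1)] .
      \<comment> \<open>The tree path from \<open>w\<close> enters the triangle at \<open>a\<close>.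
        Its last outer vertex \<open>z\<close> has sum at least 3, either as \<open>w\<close> itself
        or because of two tree edges.\<close>
      then obtain z a where z: "z \<notin> {x, y, q}" "a \<in> {x, y, q}" "{z, a} \<in> A"
        and zw: "z = w \<or> (\<exists>z'. z' \<notin> {x, y, q} \<and> {z', z} \<in> A)"
        using conn_enters[of A w q "{x, y, q}"] 4 by blast
      have zV: "z \<in> V" using edge_V[of z a] z(3) subs(1) by blast
      have z3: "nsum E f z \<ge> 3"
      proof (cases "z = w")
        case False
        then obtain z' where z': "z' \<notin> {x, y, q}" "{z', z} \<in> A" using zw by blast
        have "{z', z} \<noteq> {z, a}" using z' z by (auto simp: doubleton_eq_iff)
        then show ?thesis using ge3[of z "{z', z}" "{z, a}"] z z' zV by auto
      qed (use w3 in simp)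
      have zE: "{z, a} \<in> E" "f {z, a} = 1" using z(3) subs(1) f_A by auto
      consider "a = q" | "a = x" | "a = y" using z(2) by blast
      then show ?thesis
      proof cases
        case 1
        then show ?thesis using good_edge[OF z(3) z3] q3 sum by blast
      next
        case 2
        have "\<exists>k'. star_fun E k' \<and> sum k' E = sum f E - 2"
          using zE 2 z yq xyE subs(1) fxy f_A qV(2) q3 z3 by (intro flip3[OF E star, of z x y q]) auto
        then show ?thesis using good_improve sum by blast
      next
        case 3
        have "\<exists>k'. star_fun E k' \<and> sum k' E = sum f E - 2"
          using zE 3 z xq yxE subs(1) fxy f_A qy q3 z3 by (intro flip3[OF E star, of z y x q]) auto
        then show ?thesis using good_improve sum by blast
      qed
    qed
  qed
qed

text \<open>\<open>A\<close> is a star with centre \<open>w\<close> and a star with centre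
  \<open>c\<close>. Both \<open>u\<close> and \<open>v\<close> are adjacent to \<open>c\<close>, so
  the shortest path is \<open>u, w, v\<close>. If \<open>B\<close> is nonempty, its edges either
  allow a flip between centres or violate balancedness.\<close>

lemma good_even_two_stars:
  assumes k1: "\<kappa> = 1" and card: "card A + 2 = card V" and R: "R = {}"
  shows good
proof (rule ccontr)
  assume ng: "\<not> good"
  have sum: "sum f E = int (card V)" using sum_f k1 card R by simp
  then have sum1: "sum f E \<le> int (card V) + 1" by simp
  have small: "ndeg A x \<le> 1 \<or> ndeg A y \<le> 1" if "{x, y} \<in> A" for x y
    using small_ends[OF R ng sum1 that] .
  note w = kappa1[OF k1]
  have wstar: "y = w \<or> {w, y} \<in> A" if "conn A w y" for y
    using w_neighbours[OF k1 R ng sum1 that] .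
  have nwu: "\<not> conn A w u"
  proof
    assume "conn A w u"
    then have "{w, u} \<in> A" using wstar w(3) by blast
    then show False using w(1) parts(2) by (auto simp: insert_commute)
  qed
  have uwE: "{u, w} \<in> E" using w(1) subs(4) by blast
  have p3: "p = [u, w, v]" if "length p \<le> 3"
  proof -
    obtain zs where zs: "p = u # w # zs" using kappa k1 by auto
    then have "length zs = 1" using that w(5) by simp
    then show ?thesis using zs path(5) by (cases zs) auto
  qed
  have nwv: "\<not> conn A w v"
  proof
    assume "conn A w v"
    then have wv: "{w, v} \<in> A" using wstar w(4) by blast
    then have "{w, v} \<in> E" using subs(1) by blast
    then have "p = [u, w, v]" using p3 path_len3[OF uwE] by blast
    then show False using wv parts(2) by auto
  qed
  have con: "conn A u y" if "y \<in> V" "\<not> conn A w y" for y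
    using conn_three[OF card w(2) uv(1) that(1) nwu that(2)] .
  obtain c where c: "conn A u c" "\<And>y. conn A u y \<Longrightarrow> y = c \<or> {c, y} \<in> A"
    using star_centre[OF fins(1) small, of u] by blast
  have nuv: "{u, v} \<notin> E" using path_len2 w(5) by auto
  have uvc: "conn A u v" using con[OF uv(2) nwv] .
  have cu: "c \<noteq> u" using c(2)[OF uvc] uv(3) nuv subs(1) by blast
  have cv: "c \<noteq> v" using c(2)[of u] uv(3) nuv subs(1) by (auto simp: insert_commute)
  have ucA: "{c, u} \<in> A" "{c, v} \<in> A" using c(2)[of u] c(2)[OF uvc] cu cv by auto
  have "{u, c} \<in> E" "{c, v} \<in> E" using ucA subs(1) by (auto simp: insert_commute)
  then have p: "p = [u, w, v]" using p3 path_len3 by blast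
  then have P: "P = {{u, w}, {w, v}}" by simp
  have cV: "c \<in> V" using conn_V[OF c(1) uv(1)] .
  have cw: "c \<noteq> w" using c(1) nwu conn_sym[of A u w] by auto
  have cover: "y = w \<or> {w, y} \<in> A \<or> y = c \<or> {c, y} \<in> A" if "y \<in> V" for y
    using wstar[of y] con[OF that] c(2)[of y] by blast
  have "ndeg A c \<ge> 2" using ndeg_ge2[OF fins(1) ucA(1) _ ucA(2), of c] uv(3) by (auto simp: doubleton_eq_iff)
  then have c3: "ndeg A c \<ge> 3" using excess_ge3[OF cV] R by simp
  have nc: "nsum E f c = ndeg A c" using nsum_f[of c] cu cv cw R by simp
  have nw: "nsum E f w = ndeg A w + 2" using nsum_f[of w] w k1 R by simp
  have w1: "ndeg A w \<ge> 1" using excess(1)[OF w(2)] R by simp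
  have uw_vw: "{u, w} \<noteq> {w, v}" using uv(3) w(3) by (auto simp: doubleton_eq_iff)
  have "nsum P h u = 1" using nsum_h[of u] uv(3) w(3) by simp
  then have huw: "h {u, w} = 1" using P uw_vw uv(3) w(3) by (simp add: nsum_def)
  have "nsum P h v = 1" using nsum_h[of v] uv(3) w(4) by simp
  then have hwv: "h {w, v} = 1" using P uw_vw uv(3) w(4) by (simp add: nsum_def)
  show False
  proof (cases "B = {}")
    case True
    then have EA: "E = insert {u, w} (insert {w, v} A)" using parts(1) P R by blast
    have fuw: "f {u, w} = 1" using w(1) huw by (simp add: psign_def)
    \<comment> \<open>Only the sum at \<open>u\<close> may drop to 0. The edge \<open>{u, w}\<close>
      tolerates this through its own sign -1; every other edge at \<open>u\<close> has, by
      \<open>end2\<close>, an end with sum at least 2.\<close>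
    define k where "k = f({u, w} := -1)"
    have nk: "nsum E k x = ndeg A x - of_bool (x = u) + of_bool (x = v)" for x
      unfolding k_def nsum_upd[OF finE uwE] fuw nsum_f using R k1 uv(3) w by auto
    have sk: "sum k E = int (card V) - 2"
      unfolding k_def sum_upd[OF finE uwE] fuw sum by simp
    have sg: "signing E k" using signing_f by (auto simp: k_def signing_def)
    have ge: "nsum E k x \<ge> (if x = u then 0 else 1)" if "x \<in> V" for x
      using excess(1)[OF that] nk[of x] R uv(3) by (auto split: if_splits)
    have end2: "nsum E k y \<ge> 2 \<or> nsum E k u \<ge> 2" if y: "{u, y} \<in> A" for y
    proof (cases "y = c")
      case True
      then show ?thesis using nk[of c] c3 cu cv by simp
    next
      case False
      then have "ndeg A u \<ge> 2"
        using ndeg_ge2[OF fins(1) ucA(1) _ y, of u] cu by (auto simp: doubleton_eq_iff)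
      then have "ndeg A u \<ge> 3" using excess_ge3[OF uv(1)] R by simp
      then show ?thesis using nk[of u] uv(3) by auto
    qed
    have "is_SEDF E k"
    proof (rule is_SEDF_I[OF E sg])
      fix x y assume xy: "{x, y} \<in> E" "x \<noteq> y"
      have V: "x \<in> V" "y \<in> V" using edge_V[OF xy(1)] by auto
      have k1': "k {x, y} \<le> 1" using sg xy(1) by (auto simp: signing_def)
      show "nsum E k x + nsum E k y - k {x, y} \<ge> 1"
      proof (cases "{x, y} = {u, w}")
        case True
        then have "k {x, y} = -1" by (simp add: k_def)
        moreover have "x \<noteq> u \<or> y \<noteq> u" using xy(2) by blast
        ultimately show ?thesis using ge[OF V(1)] ge[OF V(2)] by (auto split: if_splits)
      next
        case False
        show ?thesis
        proof (cases "x = u \<or> y = u")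
          case True
          moreover have "{x, y} \<noteq> {w, v}" using True uv(3) w(3) by (auto simp: doubleton_eq_iff)
          ultimately have "x = u \<and> {u, y} \<in> A \<or> y = u \<and> {u, x} \<in> A"
            using xy(1) EA False by (auto simp: insert_commute)
          then have "nsum E k x \<ge> 2 \<or> nsum E k y \<ge> 2" using end2[of x] end2[of y] by blast
          then show ?thesis using ge[OF V(1)] ge[OF V(2)] k1' by (auto split: if_splits)
        next
          case False
          then show ?thesis using ge[OF V(1)] ge[OF V(2)] k1' by simp
        qed
      qed
    qed
    then show False using ng sk by (auto simp: good_def)
  next
    case False
    have c_leaf: "{w, x} \<in> A \<or> {c, x} \<in> A" if "x \<in> V" "x \<noteq> w" "x \<noteq> c" for x
      using cover[OF that(1)] that(2,3) by blast
    have no_wc: "{w, c} \<notin> B"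
    proof
      assume wc: "{w, c} \<in> B"
      obtain k where k: "star_fun E k" "k {w, c} = 1" "\<forall>x. nsum E k x = nsum E f x" "sum k E = sum f E"
        using signed_base[OF wc, of 1] by blast
      have "{w, c} \<in> E" using wc subs(2) by blast
      then show False
        using flip1[OF E k(1), of w c] good_improve[of k] k nw nc c3 w1 sum1 ng by auto
    qed
    have no_leaf: False if xy: "{x, y} \<in> B" "x \<noteq> w" "x \<noteq> c" "y \<noteq> w" "y \<noteq> c" for x y
    proof -
      have xyE: "{x, y} \<in> E" using xy(1) subs(2) by blast
      have V: "x \<in> V" "y \<in> V" "x \<noteq> y" using edge_V[OF xyE] by auto
      obtain k where k: "star_fun E k" "k {x, y} = -1" "\<forall>d\<in>A. k d = 1" "\<forall>d\<in>P. k d = h d"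
        "\<forall>x. nsum E k x = nsum E f x" "sum k E = sum f E"
        using signed_base[OF xy(1), of "-1"] by blast
      have trail: "False" if t: "{a, x} \<in> E" "k {a, x} = 1" "{b, y} \<in> E" "k {b, y} = 1"
        "a \<in> {w, c}" "b \<in> {w, c}" and ab: "a = b \<Longrightarrow> nsum E f a \<ge> 5" for a b
      proof -
        have "nsum E k a \<ge> 3" "nsum E k b \<ge> 3" using t(5,6) nw nc w1 c3 k(5) by auto
        then have "\<exists>k'. star_fun E k' \<and> sum k' E = sum k E - 2"
          using t xy xyE k(2,5) ab by (intro flip3[OF E k(1), of a x y b]) (auto simp: insert_commute)
        then show False using good_improve[of k] k(6) sum1 ng by simp
      qed
      have A1: "{a, b} \<in> E" "k {a, b} = 1" if ab: "{a, b} \<in> A" for a b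
        using subsetD[OF subs(1) ab] bspec[OF k(3) ab] by blast+
      \<comment> \<open>The two path edges at \<open>w\<close> are positive. If both ends of an edge
        of \<open>B\<close> hang on \<open>c\<close> but one of them is \<open>u\<close> or
        \<open>v\<close>, the trail can start at \<open>w\<close> and need not be closed.\<close>
      have P1: "{w, z} \<in> E \<and> k {w, z} = 1" if z: "z = u \<or> z = v" for z
      proof -
        have z': "{w, z} \<in> P" "h {w, z} = 1" using z P huw hwv by (auto simp: insert_commute)
        show ?thesis using bspec[OF k(4) z'(1)] z'(2) subsetD[OF subs(4) z'(1)] by simp
      qed
      have w5: "nsum E f w \<ge> 5" if "{w, x} \<in> A" "{w, y} \<in> A"
      proof -
        have "ndeg A w \<ge> 2"
          using ndeg_ge2[OF fins(1) that(1) _ that(2), of w] V(3) by (auto simp: doubleton_eq_iff)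
        then show ?thesis using excess_ge3[OF w(2)] nw R by simp
      qed
      have c5: "nsum E f c \<ge> 5" if "{c, x} \<in> A" "{c, y} \<in> A" "x \<notin> {u, v}" "y \<notin> {u, v}"
      proof -
        \<comment> \<open>Four neighbours and an odd degree give degree at least 5.\<close>
        have "card {u, v, x, y} = 4" using V(3) that(3,4) uv(3) by auto
        then have "ndeg A c \<ge> 4"
          using ndeg_ge_neighbours[OF fins(1), of "{u, v, x, y}" c] that(1,2) ucA by auto
        moreover have "ndeg A c \<noteq> 4" using excess(2)[OF cV] R by auto
        ultimately show ?thesis using nc by linarith
      qed
      consider "{w, x} \<in> A" "{w, y} \<in> A" | "{w, x} \<in> A" "{c, y} \<in> A" | "{c, x} \<in> A" "{w, y} \<in> A"
        | "{c, x} \<in> A" "{c, y} \<in> A"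
        using c_leaf[OF V(1) xy(2,3)] c_leaf[OF V(2) xy(4,5)] by blast
      then show False
      proof cases
        case 1
        then show ?thesis using trail[of w w] A1 w5 by blast
      next
        case 2
        then show ?thesis using trail[of w c] A1 cw by blast
      next
        case 3
        then show ?thesis using trail[of c w] A1 cw by blast
      next
        case 4
        consider "x \<in> {u, v}" | "y \<in> {u, v}" | "x \<notin> {u, v}" "y \<notin> {u, v}" by blast
        then show ?thesis
        proof cases
          case 1
          then show ?thesis using trail[of w c] A1[OF 4(2)] P1[of x] cw by blast
        next
          case 2
          then show ?thesis using trail[of c w] A1[OF 4(1)] P1[of y] cw by blast
        next
          case 3
          then show ?thesis using trail[of c c] A1[OF 4(1)] A1[OF 4(2)] c5[OF 4 3] by blast
        qed
      qed
    qed
    obtain e where e: "e \<in> B" using False by blast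
    then obtain a b where ab: "e = {a, b}" "a \<noteq> b" using edges2D[OF E] subs(2) by blast
    \<comment> \<open>All edges of \<open>B\<close> now join a leaf to the centre of the other star, so leaves have degree at most
      one in \<open>B\<close>, contradicting balancedness.\<close>
    have "\<exists>k x. k \<in> {w, c} \<and> x \<notin> {w, c} \<and> {k, x} \<in> B"
    proof (cases "a \<in> {w, c}")
      case True
      then have "b \<notin> {w, c}" using no_wc e ab by (auto simp: insert_commute)
      then show ?thesis using True e ab by blast
    next
      case False
      then have "b \<in> {w, c}" using no_leaf[of a b] e ab by blast
      moreover have "{b, a} \<in> B" using e ab by (simp add: insert_commute)
      ultimately show ?thesis using False by blast
    qed
    then obtain k x where kx: "k \<in> {w, c}" "x \<notin> {w, c}" "{k, x} \<in> B" by blast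
    obtain d where d: "d \<in> B" "d \<noteq> {k, x}" "x \<in> d"
      using balanced_other_edge[OF fins(2) bal kx(3), of x] by blast
    obtain y where y: "d = {x, y}"
      using edges2D[OF E, of d] d(1,3) subs(2) by (auto simp: doubleton_eq_iff)
    have "y \<in> {w, c}" using no_leaf[of x y] d(1) y kx(2) by blast
    moreover have "y \<noteq> k" using d(2) y by (auto simp: insert_commute)
    ultimately have "{w, x} \<in> B" "{c, x} \<in> B" using kx d(1) y by (auto simp: insert_commute)
    moreover have "{w, x} \<in> A \<or> {c, x} \<in> A"
      using c_leaf[of x] kx edge_V[of k x] subs(2) by blast
    ultimately show False using parts(5) by blast
  qed
qed

text \<open>The total \<open>|A| - |R| + 1 + \<kappa>\<close> with \<open>|A| \<le> n - 1\<close>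
  reaches \<open>n\<close> only in one case for \<kappa> = 0 and in three cases for \<kappa> =
  1.\<close>

lemma all_good: good
proof (rule ccontr)
  assume ng: "\<not> good"
  have "\<not> sum f E \<le> int (card V) - 1" using goodI[OF star_f[OF bal]] ng by blast
  then have big: "int (card A) - int (card R) + 1 + \<kappa> \<ge> int (card V)" using sum_f by simp
  have R0: "R = {}" if "card R = 0" using that fins(3) by simp
  from kappa show False
  proof
    assume k: "\<kappa> = 0 \<and> even (length p)"
    then have "card A + 1 = card V" "card R = 0" using big card_A by auto
    then show False using good_odd_spanning R0 k ng by blast
  next
    assume k: "\<kappa> = 1 \<and> odd (length p) \<and> (\<exists>zs. p = u # w # zs)"
    then have "card A + 1 = card V \<and> card R = 0 \<or> card A + 1 = card V \<and> card R = 1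
      \<or> card A + 2 = card V \<and> card R = 0" using big card_A by auto
    then show False
    proof (elim disjE conjE)
      assume "card A + 1 = card V" "card R = 0"
      then show ?thesis using good_even_spanning R0 k ng by blast
    next
      assume c: "card A + 1 = card V" "card R = 1"
      obtain e where e: "R = {e}" using card_1_singletonE[OF c(2)] by blast
      then obtain x y where "e = {x, y}" using edges2D[OF E, of e] subs(3) by blast
      then show ?thesis using good_even_chord[of x y] e c(1) k ng by blast
    next
      assume "card A + 2 = card V" "card R = 0"
      then show ?thesis using good_even_two_stars R0 k ng by blast
    qed
  qed
qed

end

section \<open>Two even vertices in the same component and in different components\<close>

lemma SEDF_two_even_connected:
  assumes finV: "finite V" and E: "edges2 E" and sub: "\<And>e. e \<in> E \<Longrightarrow> e \<subseteq> V"
    and uv: "u \<in> V" "v \<in> V" "u \<noteq> v" and con: "conn E u v"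
    and parity: "\<And>x. x \<in> V \<Longrightarrow> odd (ndeg E x) \<longleftrightarrow> x \<noteq> u \<and> x \<noteq> v"
  shows "\<exists>k. is_SEDF E k \<and> sum k E \<le> int (card V) - 1"
proof -
  define Q where "Q q \<longleftrightarrow> distinct q \<and> pedges q \<subseteq> E \<and> q \<noteq> [] \<and> hd q = u \<and> last q = v" for q
  obtain p0 where "Q p0" using conn_path[OF con] by (auto simp: Q_def)
  then obtain p where "Q p" and shortest: "\<And>q. Q q \<Longrightarrow> length p \<le> length q"
    using ex_has_least_nat[of Q p0 length] by blast
  then have path: "distinct p" "pedges p \<subseteq> E" "p \<noteq> []" "hd p = u" "last p = v"
    by (simp_all add: Q_def)
  obtain B g A R where D: "decomp (E - pedges p) B g A R"
    using decomp_exists[OF edges2_subset[OF E, of "E - pedges p"]] by blast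
  obtain q zs where p: "p = u # q # zs"
    using path(3-5) uv(3) by (cases p; cases "tl p") auto
  have "\<exists>h \<kappa> w. signing (pedges p) h
    \<and> (\<forall>x. nsum (pedges p) h x = of_bool (x = u) + of_bool (x = v) + 2 * \<kappa> * of_bool (x = w))
    \<and> sum h (pedges p) = 1 + \<kappa>
    \<and> (\<kappa> = 0 \<and> even (length p) \<or> \<kappa> = 1 \<and> odd (length p) \<and> (\<exists>zs. p = u # w # zs))"
  proof (cases "even (length zs)")
    case True
    have lv: "last (q # zs) = v" using p path(5) by simp
    obtain h where h: "signing (pedges p) h"
      "\<forall>x. nsum (pedges p) h x = of_bool (x = u)
        + (if even (length zs) then 1 else -1) * of_bool (x = last (q # zs))"
      "sum h (pedges p) = of_bool (even (length zs))"
      using path_signing[of u q zs] path(1) unfolding p by blast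
    then show ?thesis
      \<comment> \<open>An even \<open>length zs\<close> means an odd number of edges, so
        alternation makes both end edges positive. The \<open>u\<close> in the place of
        \<open>w\<close> is a placeholder, since \<kappa> = 0 removes its term.\<close>
      using True lv p by (intro exI[of _ h] exI[of _ 0] exI[of _ u]) simp
  next
    case False
    then obtain z zs' where z: "zs = z # zs'" by (cases zs) auto
    have ev: "even (length zs')" using False z by simp
    have lv: "last (z # zs') = v" using p path(5) z by simp
    \<comment> \<open>Alternation starts at the second vertex \<open>q\<close>, from which an odd
      number of edges is left. The first edge is then positive as well, which gives \<open>q\<close>
      the sum 2.\<close>
    let ?P = "pedges (q # z # zs')"
    obtain h where h: "signing ?P h"
      "\<forall>x. nsum ?P h x = of_bool (x = q)
        + (if even (length zs') then 1 else -1) * of_bool (x = last (z # zs'))"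
      "sum h ?P = of_bool (even (length zs'))"
      using path_signing[of q z zs'] path(1) p z by auto
    have new: "{u, q} \<notin> ?P" using pedges_subset[of "{u, q}" "q # z # zs'"] path(1) p z by auto
    have P: "pedges p = insert {u, q} ?P" using p z by simp
    have fin: "finite ?P" by (rule finite_pedges)
    have "u \<noteq> q" using path(1) p by simp
    then have "nsum (pedges p) (h({u, q} := 1)) x
        = of_bool (x = u) + of_bool (x = v) + 2 * 1 * of_bool (x = q)" for x
      unfolding P nsum_insert_upd[OF fin new] h(2)[rule_format] lv using ev by auto
    moreover have "sum (h({u, q} := 1)) (pedges p) = 1 + 1"
    proof -
      have "sum (h({u, q} := 1)) ?P = sum h ?P" by (rule sum.cong) (use new in auto)
      then show ?thesis unfolding P using new h(3) ev by (simp del: pedges.simps)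
    qed
    moreover have "signing (pedges p) (h({u, q} := 1))"
      unfolding P using h(1) by (intro signing_insert_upd) auto
    moreover have "odd (length p)" using p z ev by simp
    ultimately show ?thesis
      using p by (intro exI[of _ "h({u, q} := 1)"] exI[of _ 1] exI[of _ q]) blast
  qed
  then obtain h \<kappa> w where h: "signing (pedges p) h"
    "\<And>x. nsum (pedges p) h x = of_bool (x = u) + of_bool (x = v) + 2 * \<kappa> * of_bool (x = w)"
    "sum h (pedges p) = 1 + \<kappa>"
    "\<kappa> = 0 \<and> even (length p) \<or> \<kappa> = 1 \<and> odd (length p) \<and> (\<exists>zs. p = u # w # zs)"
    by blast
  have shortest': "length p \<le> length q"
    if "distinct q" "pedges q \<subseteq> E" "q \<noteq> []" "hd q = u" "last q = v" for q
    using that by (intro shortest) (simp add: Q_def)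
  interpret path_decomp V E u v w p h g \<kappa> B A R
    by (rule path_decomp.intro; fact finV E sub uv path shortest' parity h D)
  show ?thesis using all_good by (simp add: good_def)
qed

text \<open>The component of \<open>u\<close> and the rest of the graph have one exceptional vertex
  each, and the two bounds add up to \<open>card V - 2\<close>.\<close>

lemma star_fun_two_components:
  assumes finV: "finite V" and E: "edges2 E" and sub: "\<And>e. e \<in> E \<Longrightarrow> e \<subseteq> V"
    and uv: "u \<in> V" "v \<in> V" and ncon: "\<not> conn E u v"
    and odd: "\<And>x. x \<in> V \<Longrightarrow> x \<noteq> u \<Longrightarrow> x \<noteq> v \<Longrightarrow> odd (ndeg E x)"
  shows "\<exists>k. star_fun E k \<and> sum k E \<le> int (card V) - 1"
proof -
  define V1 where "V1 = {x \<in> V. conn E u x}"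
  define V2 where "V2 = V - V1"
  define E1 where "E1 = {e \<in> E. e \<subseteq> V1}"
  define E2 where "E2 = E - E1"
  have sub1: "E1 \<subseteq> E" "E2 \<subseteq> E" by (auto simp: E1_def E2_def)
  have E12: "edges2 E1" "edges2 E2" using edges2_subset[OF E] sub1 by blast+
  have fin: "finite E1" "finite E2" "E1 \<inter> E2 = {}" "E = E1 \<union> E2"
    using edges2_finite E12 by (auto simp: E1_def E2_def)
  have E2V: "e \<subseteq> V2" if e: "e \<in> E2" for e
  proof -
    obtain x y where xy: "e = {x, y}" using edges2D[OF E12(2) e] by blast
    have eE: "{x, y} \<in> E" "{y, x} \<in> E" using e sub1 xy by (auto simp: insert_commute)
    have "conn E u x \<longleftrightarrow> conn E u y"
      using conn_edge[OF eE(1)] conn_edge[OF eE(2)] conn_trans by metis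
    then show ?thesis using e sub[of e] sub1 xy by (auto simp: E2_def E1_def V2_def V1_def)
  qed
  have E1V: "e \<subseteq> V1" if "e \<in> E1" for e using that by (simp add: E1_def)
  have n1: "nsum E k x = nsum E1 k x" if "x \<in> V1" for k x
  proof -
    have "nsum E2 k x = 0" by (rule nsum_outside) (use E2V that V2_def in blast)
    then show ?thesis using nsum_Un[OF fin(1-3), of k x] fin(4) by simp
  qed
  have n2: "nsum E k x = nsum E2 k x" if "x \<in> V2" for k x
  proof -
    have "nsum E1 k x = 0" by (rule nsum_outside) (use E1V that V2_def in blast)
    then show ?thesis using nsum_Un[OF fin(1-3), of k x] fin(4) by simp
  qed
  have mem: "u \<in> V1" "v \<in> V2" using uv ncon by (auto simp: V1_def V2_def)
  have finV': "finite V1" "finite V2" "V1 \<inter> V2 = {}" "V = V1 \<union> V2"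
    using finV by (auto simp: V1_def V2_def)
  have "odd (ndeg E1 x)" if "x \<in> V1" "x \<noteq> u" for x
    using odd[of x] n1[of x "\<lambda>_. 1"] that mem finV' by auto
  then obtain k1 where k1: "star_fun E1 k1" "sum k1 E1 \<le> int (card V1) - 1"
    using star_fun_one_exception[OF finV'(1) E12(1) E1V mem(1)] by blast
  have "odd (ndeg E2 x)" if "x \<in> V2" "x \<noteq> v" for x
    using odd[of x] n2[of x "\<lambda>_. 1"] that mem finV' by auto
  then obtain k2 where k2: "star_fun E2 k2" "sum k2 E2 \<le> int (card V2) - 1"
    using star_fun_one_exception[OF finV'(2) E12(2) E2V mem(2)] by blast
  define k where "k e = (if e \<in> E1 then k1 e else k2 e)" for e
  have kk: "k e = k1 e" if "e \<in> E1" for e using that by (simp add: k_def)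
  have kk2: "k e = k2 e" if "e \<in> E2" for e using that fin(3) by (auto simp: k_def)
  have "signing E k" using k1(1) k2(1) kk kk2 fin(4) by (auto simp: star_fun_def signing_def)
  moreover have "nsum E k x \<ge> 1" if e: "e \<in> E" "x \<in> e" for e x
  proof (cases "e \<in> E1")
    case True
    then have "x \<in> V1" using E1V e(2) by blast
    then show ?thesis
      using n1[of x k] True e(2) k1(1) nsum_cong[of E1 k k1, OF kk] by (simp add: star_fun_def)
  next
    case False
    then have "e \<in> E2" using e fin(4) by blast
    moreover have "x \<in> V2" using E2V[OF calculation] e(2) by blast
    ultimately show ?thesis
      using n2[of x k] e(2) k2(1) nsum_cong[of E2 k k2, OF kk2] by (simp add: star_fun_def)
  qed
  moreover have "sum k E = sum k1 E1 + sum k2 E2"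
  proof -
    have "sum k E1 = sum k1 E1" by (rule sum.cong[OF refl kk])
    moreover have "sum k E2 = sum k2 E2" by (rule sum.cong[OF refl kk2])
    ultimately show ?thesis using sum.union_disjoint[OF fin(1-3), of k] fin(4) by simp
  qed
  moreover have "card V = card V1 + card V2"
    using card_Un_disjoint[OF finV'(1-3)] finV'(4) by simp
  ultimately show ?thesis
    using k1(2) k2(2) by (intro exI[of _ k]) (auto simp: star_fun_def)
qed

theorem theorem1p2:
  fixes V :: "'a set" and E :: "'a set set"
  assumes "simple_graph V E"
    and "v_even V E \<in> {1, 2}"
  shows "signed_edge_domination_number E \<le> int (card V) - 1"
proof -
  have finV: "finite V" and sub: "\<And>e. e \<in> E \<Longrightarrow> e \<subseteq> V" and c2: "\<forall>e\<in>E. card e = 2"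
    using assms(1) by (auto simp: simple_graph_def)
  have "E \<subseteq> Pow V" using sub by blast
  then have finE: "finite E" using finV finite_subset by (metis finite_Pow_iff)
  then have E: "edges2 E" using c2 by (simp add: edges2_def)
  let ?W = "{x \<in> V. even (degree E x)}"
  have "\<exists>k. is_SEDF E k \<and> sum k E \<le> int (card V) - 1"
  proof (cases "card ?W = 1")
    case True
    then obtain u where u: "?W = {u}" by (rule card_1_singletonE)
    then have "odd (ndeg E x)" if "x \<in> V" "x \<noteq> u" for x
      using that ndeg_degree[OF finE, of x] by auto
    then show ?thesis
      using star_fun_one_exception[OF finV E sub, of u] u star_fun_is_SEDF[OF E] by blast
  next
    case False
    then have "card ?W = 2" using assms(2) by (simp add: v_even_def)
    then obtain u v where uv: "?W = {u, v}" "u \<noteq> v" by (auto simp: card_2_iff)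
    have uvV: "u \<in> V" "v \<in> V" using uv(1) by blast+
    have par: "odd (ndeg E x) \<longleftrightarrow> x \<noteq> u \<and> x \<noteq> v" if "x \<in> V" for x
    proof -
      have "even (degree E x) \<longleftrightarrow> x \<in> {u, v}" using that uv(1) by blast
      then show ?thesis using ndeg_degree[OF finE, of x] by simp
    qed
    show ?thesis
    proof (cases "conn E u v")
      case True
      show ?thesis by (rule SEDF_two_even_connected[OF finV E sub uvV uv(2) True par])
    next
      case False
      then show ?thesis
        using star_fun_two_components[OF finV E sub uvV False] par star_fun_is_SEDF[OF E] by blast
    qed
  qed
  then obtain k where "is_SEDF E k" "sum k E \<le> int (card V) - 1" by blast
  then show ?thesis using sedn_le[OF finE, of k] by simp
qed

end
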